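(* Let $r\in\mathbb{N}$, let $\overrightarrow{\mathscr{P}}=(p_1,\dots,p_r)$ with $1\le p_1\le p_2\le\dots\le p_r<\infty$, and let $f\in L^{\overrightarrow{\mathscr{P}}}([-1,1]^r)$. Then for every $\epsilon>0$ there exists $n\in\mathbb{N}$ such that $$\|f-K_nf\|_{\overrightarrow{\mathscr{P}}}<\epsilon.$$
   Context: Write $\mathcal{J}=[-1,1]^r$. Mixed norm Lebesgue space: for $\overrightarrow{\mathscr{P}}=(p_1,\dots,p_r)\in[1,\infty)^r$ and measurable $f:\mathcal{J}\to\mathbb{R}$, $$\|f\|_{\overrightarrow{\mathscr{P}}}=\left(\int_{-1}^{1}\cdots\left(\int_{-1}^{1}\left(\int_{-1}^{1}|f(x_1,\dots,x_r)|^{p_1}dx_1\right)^{\frac{p_2}{p_1}}dx_2\right)^{\frac{p_3}{p_2}}\cdots dx_r\right)^{\frac1{p_r}},$$ and $L^{\overrightarrow{\mathscr{P}}}(\mathcal{J})$ is the set of measurable $f$ with $\|f\|_{\overrightarrow{\mathscr{P}}}<\infty$. Activation function: $\rho:\mathbb{R}\to\mathbb{R}$ is a fixed non-decreasing sigmoidal function, i.e. $\lim_{x\to-\infty}\rho(x)=0$ and $\lim_{x\to\infty}\rho(x)=1$. Its univariate density function is $\Psi_\rho(x)=\frac12\big(\rho(x+1)-\rho(x-1)\big)$, $x\in\mathbb{R}$, and its multivariate density function is $\Psi_\rho(\mathbf{x})=\Psi_\rho(x_1)\cdots\Psi_\rho(x_r)$ for $\mathbf{x}=(x_1,\dots,x_r)\in\mathbb{R}^r$.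 Standing assumptions on $\Psi_\rho$: $\Psi_\rho(x)=\mathcal{O}(|x|^{-\eta})$ as $x\to\pm\infty$ for some $\eta>1$; $\int_{\mathbb{R}}\Psi_\rho(t)\,dt=1$; $\sum_{k\in\mathbb{Z}}\Psi_\rho(x-k)=1$ for every $x\in\mathbb{R}$, the series converging uniformly on compact sets; and, for all $n\in\mathbb{N}$ and $x\in[-1,1]$, $\sum_{k=-n}^{n-1}\Psi_\rho(nx-k)\ge\Psi_\rho(2)>0$. Multivariate Kantorovich-type neural network operators: for integrable $f:\mathcal{J}\to\mathbb{R}$, $n\in\mathbb{N}$ and $\mathbf{x}\in\mathcal{J}$, $$K_nf(\mathbf{x})=K_n(f,\mathbf{x})=\frac{\sum_{\mathbf{k}\in\{-n,\dots,n-1\}^r}\left(n^r\int_{I_{\mathbf{k},n}}f(\mathbf{t})\,d\mathbf{t}\right)\Psi_\rho(n\mathbf{x}-\mathbf{k})}{\sum_{\mathbf{k}\in\{-n,\dots,n-1\}^r}\Psi_\rho(n\mathbf{x}-\mathbf{k})},\qquad I_{\mathbf{k},n}=\prod_{j=1}^{r}\left[\frac{k_j}{n},\frac{k_j+1}{n}\right].$$ *)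

theory Defs
  imports "HOL-Analysis.Analysis" "HOL-Library.Landau_Symbols"
begin

text \<open>
  Points of \<open>r\<close>-dimensional space are the functions in \<open>{1..r} \<rightarrow>\<^sub>E UNIV\<close>, so that the dimension is an
  ordinary natural number and the coordinates carry the order in which the mixed norm integrates.
  A real function on the cube is a total function whose values off the cube are never used.
\<close>

definition cube :: "nat \<Rightarrow> (nat \<Rightarrow> real) set" where
  "cube r = {1..r} \<rightarrow>\<^sub>E {-1..1}"

definition lebesgue_space :: "nat \<Rightarrow> (nat \<Rightarrow> real) measure" where
  "lebesgue_space r = completion (Pi\<^sub>M {1..r} (\<lambda>_. lborel))"

text \<open>Only used for a positive exponent \<open>a\<close>.\<close>

definition ennreal_powr :: "ennreal \<Rightarrow> real \<Rightarrow> ennreal" where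
  "ennreal_powr y a = (if y = \<infinity> then \<infinity> else ennreal (enn2real y powr a))"

text \<open>
  \<open>mixed_integral p f j x\<close> is the result of the \<open>j\<close> innermost integrations, over the coordinates
  \<open>1, \<dots>, j\<close> in this order; it depends on \<open>x\<close> only through the coordinates above \<open>j\<close>. In particular
  \<open>mixed_integral p f r x\<close> is independent of \<open>x\<close> on the coordinates \<open>1, \<dots>, r\<close>, and evaluating it at
  \<open>\<lambda>_. undefined\<close> makes all arguments passed to \<open>f\<close> extensional. The value \<open>\<infinity>\<close> is allowed
  at every stage. For a Lebesgue measurable \<open>f\<close> the sections are measurable only almost everywhere;
  the exceptional null sets do not influence the outer integrals.
\<close>

fun mixed_integral ::
  "(nat \<Rightarrow> real) \<Rightarrow> ((nat \<Rightarrow> real) \<Rightarrow> real) \<Rightarrow> nat \<Rightarrow> (nat \<Rightarrow> real) \<Rightarrow> ennreal" where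
  "mixed_integral p f 0 x = ennreal \<bar>f x\<bar>"
| "mixed_integral p f (Suc j) x =
     (\<integral>\<^sup>+ t\<in>{-1..1}.
        ennreal_powr (mixed_integral p f j (x(Suc j := t)))
          (if j = 0 then p 1 else p (Suc j) / p j) \<partial>lebesgue)"

definition mixed_norm :: "nat \<Rightarrow> (nat \<Rightarrow> real) \<Rightarrow> ((nat \<Rightarrow> real) \<Rightarrow> real) \<Rightarrow> ennreal" where
  "mixed_norm r p f = ennreal_powr (mixed_integral p f r (\<lambda>_. undefined)) (1 / p r)"

definition mixed_Lp :: "nat \<Rightarrow> (nat \<Rightarrow> real) \<Rightarrow> ((nat \<Rightarrow> real) \<Rightarrow> real) set" where
  "mixed_Lp r p =
     {f \<in> borel_measurable (restrict_space (lebesgue_space r) (cube r)). mixed_norm r p f < \<infinity>}"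

definition sigmoidal :: "(real \<Rightarrow> real) \<Rightarrow> bool" where
  "sigmoidal \<rho> \<longleftrightarrow> (\<rho> \<longlongrightarrow> 0) at_bot \<and> (\<rho> \<longlongrightarrow> 1) at_top"

definition uni_density :: "(real \<Rightarrow> real) \<Rightarrow> real \<Rightarrow> real" where
  "uni_density \<rho> x = (\<rho> (x + 1) - \<rho> (x - 1)) / 2"

definition multi_density :: "nat \<Rightarrow> (real \<Rightarrow> real) \<Rightarrow> (nat \<Rightarrow> real) \<Rightarrow> real" where
  "multi_density r \<rho> x = (\<Prod>j\<in>{1..r}. uni_density \<rho> (x j))"

definition grid :: "nat \<Rightarrow> nat \<Rightarrow> (nat \<Rightarrow> int) set" where
  "grid r n = {1..r} \<rightarrow>\<^sub>E {- int n..int n - 1}"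

definition cell :: "nat \<Rightarrow> (nat \<Rightarrow> int) \<Rightarrow> nat \<Rightarrow> (nat \<Rightarrow> real) set" where
  "cell r k n =
     (\<Pi>\<^sub>E j\<in>{1..r}. {real_of_int (k j) / real n..(real_of_int (k j) + 1) / real n})"

definition kantorovich_op ::
  "nat \<Rightarrow> (real \<Rightarrow> real) \<Rightarrow> nat \<Rightarrow> ((nat \<Rightarrow> real) \<Rightarrow> real) \<Rightarrow> (nat \<Rightarrow> real) \<Rightarrow> real" where
  "kantorovich_op r \<rho> n f x =
     (\<Sum>k\<in>grid r n.
        (real n ^ r * (LINT t:cell r k n|lebesgue_space r. f t)) *
          multi_density r \<rho> (\<lambda>j. real n * x j - real_of_int (k j))) /
     (\<Sum>k\<in>grid r n. multi_density r \<rho> (\<lambda>j. real n * x j - real_of_int (k j)))"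

end

theory Submission
  imports Defs "HOL-Probability.Probability"
begin

text \<open>
  The operator \<open>K\<^sub>n\<close> averages \<open>f\<close> against a tensor product kernel with row integrals \<open>1\<close> and column
  integrals at most \<open>2 / \<Psi>(2)\<close>, so that \<open>\<bar>f x - K\<^sub>n f x\<bar>\<close> is at most the \<open>K\<^sub>n\<close>-average of \<open>\<bar>f t - f x\<bar>\<close>
  over \<open>t\<close>. Because \<open>p\<close> increases, every exponent \<open>p\<^sub>j\<^sub>+\<^sub>1 / p\<^sub>j\<close> in the iterated integral is at least
  \<open>1\<close>. Jensen's inequality therefore moves each power inside the average, and the column bound disposes of
  the variable just integrated: averaging is bounded for the iterated integral, uniformly in \<open>n\<close>.
  Truncating \<open>f\<close> leaves a remainder of small mixed norm by dominated convergence. For a bounded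
  function the iterated integral is dominated by the \<open>L\<^sup>1\<close> norm, so it remains to see that the mean of
  \<open>\<bar>f t - f x\<bar>\<close> over the kernel tends to \<open>0\<close>. The sets whose indicators have this property form a
  \<open>\<sigma>\<close>-algebra, and it contains the half spaces \<open>{x. x\<^sub>i \<le> a}\<close> since the kernels concentrate at the diagonal.
\<close>

section \<open>Powers of extended nonnegative reals\<close>

text \<open>On bounded functions the mixed norm is controlled by the \<open>L^1\<close> norm only
  with a constant that depends on the bound. This dictates the order of choices: the truncation
  level is fixed by estimates uniform in \<open>n\<close>, and \<open>n\<close> comes last.
  Uniformity is therefore built into the statements, whose constants precede the kernels and the
  integrands. The estimates concern iterated integrals before the final root; there a crude
  inequality with a constant replaces Minkowski's, since only smallness matters. Averaging
  \<open>\<bar>f t - f x\<bar>\<close> instead of estimating the signed difference keeps all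
  integrands nonnegative, so Tonelli's theorem applies in the extended reals. Lebesgue measure on
  the interval is normalised to a probability measure, which is the source of the factors 2 and
  \<open>2 ^ r\<close>. A Lebesgue measurable \<open>f\<close> is exchanged for a Borel function,
  because the induction over coordinates needs measurable sections.\<close>

lemma ennreal_powr_top [simp]: "ennreal_powr \<top> a = \<top>"
  by (simp add: ennreal_powr_def)

lemma ennreal_powr_of_ennreal: "0 \<le> y \<Longrightarrow> ennreal_powr (ennreal y) a = ennreal (y powr a)"
  by (simp add: ennreal_powr_def)

lemma ennreal_powr_0 [simp]: "ennreal_powr 0 a = 0"
  by (simp add: ennreal_powr_def)

lemma ennreal_powr_1 [simp]: "ennreal_powr y 1 = y"
  by (cases y) (simp_all add: ennreal_powr_of_ennreal)

lemma ennreal_powr_mono: "y \<le> z \<Longrightarrow> 0 \<le> a \<Longrightarrow> ennreal_powr y a \<le> ennreal_powr z a"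
  by (cases y; cases z) (auto simp: ennreal_powr_of_ennreal powr_mono2 ennreal_leI top_unique)

lemma ennreal_powr_less_top_iff: "ennreal_powr y a < \<top> \<longleftrightarrow> y < \<top>"
  by (simp add: ennreal_powr_def less_top)

lemma ennreal_powr_eq_top_iff [simp]: "ennreal_powr y a = \<top> \<longleftrightarrow> y = \<top>"
  by (simp add: ennreal_powr_def)

lemma ennreal_powr_mult: "c < \<top> \<Longrightarrow> ennreal_powr (c * y) a = ennreal_powr c a * ennreal_powr y a"
proof (cases y)
  case (real y')
  assume "c < \<top>"
  then obtain c' where "c = ennreal c'" "0 \<le> c'"
    by (cases c) auto
  with real show ?thesis
    by (simp add: ennreal_powr_of_ennreal powr_mult flip: ennreal_mult)
next
  case top
  assume "c < \<top>"
  then obtain c' where c': "c = ennreal c'" "0 \<le> c'"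
    by (cases c) auto
  show ?thesis
  proof (cases "c' = 0")
    case False
    then show ?thesis
      using c' top by (simp add: ennreal_powr_of_ennreal ennreal_mult_top)
  qed (use c' in simp)
qed

lemma measurable_ennreal_powr [measurable]:
  "f \<in> borel_measurable M \<Longrightarrow> (\<lambda>x. ennreal_powr (f x) a) \<in> borel_measurable M"
proof -
  assume [measurable]: "f \<in> borel_measurable M"
  have "{x \<in> space M. f x = \<infinity>} = f -` {\<top>} \<inter> space M"
    by auto
  also have "\<dots> \<in> sets M"
    by (rule measurable_sets[of f M borel]) auto
  finally have [measurable]: "{x \<in> space M. f x = \<infinity>} \<in> sets M" .
  show ?thesis
    unfolding ennreal_powr_def by (intro measurable_If) auto
qed

text \<open>The sum is at most twice the larger summand. The constant is crude but depends on the
  exponent alone.\<close>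

lemma ennreal_powr_add_le:
  assumes "0 \<le> a"
  shows "ennreal_powr (y + z) a \<le> ennreal (2 powr a) * (ennreal_powr y a + ennreal_powr z a)"
proof -
  have "ennreal_powr (y + z) a \<le> ennreal_powr (2 * max y z) a"
    using assms by (intro ennreal_powr_mono) (auto simp: mult_2 intro!: add_mono)
  also have "\<dots> = ennreal (2 powr a) * ennreal_powr (max y z) a"
    using ennreal_powr_mult[of "ennreal 2" "max y z" a] ennreal_powr_of_ennreal[of 2 a] by simp
  also have "\<dots> \<le> ennreal (2 powr a) * (ennreal_powr y a + ennreal_powr z a)"
    by (intro mult_left_mono) (auto simp: max_def add_increasing add_increasing2)
  finally show ?thesis .
qed

text \<open>One factor \<open>y\<close> is kept and the remaining power \<open>a - 1\<close> is
  bounded by its value at \<open>B\<close>. In this way the powers of a bounded function are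
  absorbed into the first power.\<close>

lemma ennreal_powr_le_linear:
  assumes "y \<le> ennreal B" "1 \<le> a" "0 \<le> B"
  shows "ennreal_powr y a \<le> ennreal (B powr (a - 1)) * y"
proof -
  obtain y' where y': "y = ennreal y'" "0 \<le> y'"
    using assms(1) by (cases y) (auto simp: top_unique)
  have "y' powr a = y' powr (a - 1) * y'"
    using y' by (cases "y' = 0") (auto simp: powr_diff)
  also have "\<dots> \<le> B powr (a - 1) * y'"
    using y' assms by (intro mult_right_mono powr_mono2) auto
  finally show ?thesis
    using y' by (simp add: ennreal_powr_of_ennreal ennreal_leI flip: ennreal_mult)
qed

text \<open>Used to transfer divergence: if the mean of a function against a probability density is
  infinite, so is the mean of its power.\<close>

lemma le_one_plus_ennreal_powr: "1 \<le> a \<Longrightarrow> y \<le> 1 + ennreal_powr y a"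
proof (cases y)
  case (real y')
  assume a: "1 \<le> a"
  have "y' \<le> 1 + y' powr a"
  proof (cases "y' \<le> 1")
    case False
    then have "y' powr 1 \<le> y' powr a"
      using a by (intro powr_mono) auto
    then show ?thesis using False by simp
  qed (simp add: add_increasing2)
  then show ?thesis
    using real by (simp add: ennreal_powr_of_ennreal ennreal_leI flip: ennreal_plus ennreal_1)
qed simp

lemma tendsto_ennreal_powr_0:
  assumes "(u \<longlongrightarrow> 0) F" "0 < a"
  shows "((\<lambda>i. ennreal_powr (u i) a) \<longlongrightarrow> 0) F"
proof -
  have ev: "\<forall>\<^sub>F i in F. u i < \<top>"
    using assms(1) by (rule order_tendstoD) simp
  have "((\<lambda>i. enn2real (u i)) \<longlongrightarrow> enn2real 0) F"
    using assms(1) by (intro tendsto_enn2real) auto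
  then have "((\<lambda>i. enn2real (u i) powr a) \<longlongrightarrow> 0 powr a) F"
    using assms by (intro tendsto_powr2 tendsto_const) (auto intro!: always_eventually)
  then have "((\<lambda>i. ennreal (enn2real (u i) powr a)) \<longlongrightarrow> ennreal 0) F"
    using assms(2) by (intro tendsto_ennrealI) simp
  moreover have "\<forall>\<^sub>F i in F. ennreal (enn2real (u i) powr a) = ennreal_powr (u i) a"
    using ev by eventually_elim (auto simp: ennreal_powr_def)
  ultimately show ?thesis
    by (simp only: tendsto_cong ennreal_0)
qed

text \<open>The tangent to \<open>y powr q\<close> at the mean \<open>a\<close> lies below the graph.\<close>

lemma ennreal_powr_Jensen:
  assumes [measurable]: "k \<in> borel_measurable M" "g \<in> borel_measurable M"
    and k1: "(\<integral>\<^sup>+ t. k t \<partial>M) = 1" and q: "1 \<le> q"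
  shows "ennreal_powr (\<integral>\<^sup>+ t. k t * g t \<partial>M) q \<le> (\<integral>\<^sup>+ t. k t * ennreal_powr (g t) q \<partial>M)"
proof (cases "\<integral>\<^sup>+ t. k t * g t \<partial>M")
  case top
  have "(\<integral>\<^sup>+ t. k t * g t \<partial>M) \<le> (\<integral>\<^sup>+ t. k t * (1 + ennreal_powr (g t) q) \<partial>M)"
    using q by (intro nn_integral_mono mult_left_mono le_one_plus_ennreal_powr) auto
  also have "\<dots> = 1 + (\<integral>\<^sup>+ t. k t * ennreal_powr (g t) q \<partial>M)"
    by (simp add: distrib_left nn_integral_add k1)
  finally show ?thesis
    using top by (simp add: top_unique)
next
  case (real a)
  show ?thesis
  proof (cases "a = 0")
    case False
    with real have a: "a > 0" by simp
    define d where "d = q * a powr (q - 1)"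
    have d: "d \<ge> 0" using q by (simp add: d_def)
    have tangent: "ennreal d * y \<le> ennreal_powr y q + ennreal ((q - 1) * a powr q)" for y
    proof (cases y)
      case (real y')
      have "d * y' \<le> y' powr q + (q - 1) * a powr q"
      proof (cases "y' = 0 \<or> q = 1")
        case True
        then show ?thesis using q real a by (auto simp: d_def)
      next
        case False
        then have y': "y' > 0" and q1: "q > 1" using real q by auto
        \<comment> \<open>Young's inequality for \<open>y'\<close> and \<open>a powr (q - 1)\<close>
          with the conjugate exponents \<open>q\<close> and \<open>q / (q - 1)\<close>; multiplied
          by \<open>q\<close> it is the tangent inequality.\<close>
        have "y' * a powr (q - 1) \<le> y' powr q / q + (a powr (q - 1)) powr (q / (q - 1)) / (q / (q - 1))"
          using q1 y' by (intro Youngs_inequality) (auto simp: field_simps)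
        moreover have "(a powr (q - 1)) powr (q / (q - 1)) = a powr q"
          using q1 by (simp add: powr_powr)
        ultimately show ?thesis
          using q1 by (simp add: d_def field_simps)
      qed
      then show ?thesis
        using real d q a
        by (simp add: ennreal_powr_of_ennreal ennreal_leI flip: ennreal_mult ennreal_plus)
    qed simp
    have "ennreal d * ennreal a \<le> (\<integral>\<^sup>+ t. k t * ennreal_powr (g t) q \<partial>M) + ennreal ((q - 1) * a powr q)"
    proof -
      have "ennreal d * ennreal a = (\<integral>\<^sup>+ t. k t * (ennreal d * g t) \<partial>M)"
        using real by (simp add: nn_integral_cmult mult.left_commute)
      also have "\<dots> \<le> (\<integral>\<^sup>+ t. k t * (ennreal_powr (g t) q + ennreal ((q - 1) * a powr q)) \<partial>M)"
        by (intro nn_integral_mono mult_left_mono tangent) auto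
      also have "\<dots> = (\<integral>\<^sup>+ t. k t * ennreal_powr (g t) q \<partial>M) + ennreal ((q - 1) * a powr q)"
        by (simp add: distrib_left nn_integral_add nn_integral_multc k1)
      finally show ?thesis .
    qed
    \<comment> \<open>At the mean the tangent meets the graph; the finite summand
      \<open>(q - 1) * a powr q\<close>, present on both sides, then cancels.\<close>
    moreover have "ennreal d * ennreal a = ennreal (a powr q) + ennreal ((q - 1) * a powr q)"
      using a q by (simp add: d_def powr_diff field_simps flip: ennreal_mult ennreal_plus)
    ultimately show ?thesis
      using real a by (simp add: ennreal_powr_of_ennreal)
  qed (use real in simp)
qed

section \<open>Iterated integrals over the cube\<close>

definition unif :: "real measure" where
  "unif = uniform_measure lborel {-1..1}"

definition cube_prob :: "nat \<Rightarrow> (nat \<Rightarrow> real) measure" where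
  "cube_prob r = Pi\<^sub>M {1..r} (\<lambda>_. unif)"

lemma sets_unif [measurable_cong, simp]: "sets unif = sets borel"
  by (simp add: unif_def)

lemma space_unif [simp]: "space unif = UNIV"
  by (simp add: unif_def)

interpretation unif: prob_space unif
  unfolding unif_def by (rule prob_space_uniform_measure) simp_all

interpretation unifs: product_sigma_finite "\<lambda>_::nat. unif"
  by standard

interpretation cube: prob_space "cube_prob r"
  unfolding cube_prob_def by (rule prob_space_PiM, rule unif.prob_space_axioms)

lemma space_cube_prob: "space (cube_prob r) = {1..r} \<rightarrow>\<^sub>E UNIV"
  by (simp add: cube_prob_def space_PiM)

lemma undefined_in_cube_prob [simp]: "(\<lambda>_. undefined) \<in> space (cube_prob r)"
  by (simp add: space_cube_prob PiE_def extensional_def)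

lemma nn_integral_unif:
  assumes "g \<in> borel_measurable borel"
  shows "2 * (\<integral>\<^sup>+ t. g t \<partial>unif) = (\<integral>\<^sup>+ t\<in>{-1..1}. g t \<partial>lborel)"
proof -
  have "(\<integral>\<^sup>+ t. g t \<partial>unif) = (\<integral>\<^sup>+ t\<in>{-1..1}. g t \<partial>lborel) / 2"
    using assms unfolding unif_def by (subst nn_integral_uniform_measure) auto
  then show ?thesis
    by (simp add: ennreal_times_divide mult.commute[of 2] ennreal_mult_divide_eq)
qed

lemma AE_unif: "(AE t in unif. P t) \<longleftrightarrow> (AE t in lborel. t \<in> {-1..1} \<longrightarrow> P t)"
  unfolding unif_def by (subst AE_uniform_measure) auto

lemma emeasure_unif:
  "A \<in> sets borel \<Longrightarrow> emeasure unif A = emeasure lborel ({-1..1} \<inter> A) / 2"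
  unfolding unif_def by (subst emeasure_uniform_measure) auto

lemma measurable_cube_upd:
  assumes "i \<in> {1..r}"
  shows "(\<lambda>z. (fst z)(i := snd z)) \<in> cube_prob r \<Otimes>\<^sub>M unif \<rightarrow>\<^sub>M cube_prob r"
  unfolding cube_prob_def
  by (rule measurable_fun_upd[where J="{1..r}"]) (use assms in auto)

lemma cube_upd_in_space:
  "x \<in> space (cube_prob r) \<Longrightarrow> i \<in> {1..r} \<Longrightarrow> x(i := t) \<in> space (cube_prob r)"
  by (auto simp: space_cube_prob PiE_def extensional_def)

lemma measurable_cube_upd_const:
  assumes "x \<in> space (cube_prob r)" "i \<in> {1..r}"
  shows "(\<lambda>t. x(i := t)) \<in> borel \<rightarrow>\<^sub>M cube_prob r"
proof -
  have "(\<lambda>t. (fst (x, t))(i := snd (x, t))) \<in> unif \<rightarrow>\<^sub>M cube_prob r"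
    using assms by (intro measurable_compose[OF _ measurable_cube_upd]) auto
  then show ?thesis by (simp cong: measurable_cong_sets)
qed

lemma measurable_cube_component:
  "i \<in> {1..r} \<Longrightarrow> (\<lambda>x. x i) \<in> cube_prob r \<rightarrow>\<^sub>M borel"
  unfolding cube_prob_def using measurable_component_singleton[of i "{1..r}" "\<lambda>_. unif"]
  by (simp cong: measurable_cong_sets)

text \<open>Fubini's theorem without a change of index set: the inner integral no longer depends on
  coordinate \<open>i\<close>, whose own integration then contributes total mass 1. So a single
  coordinate can be integrated inside the full cube.\<close>

lemma nn_integral_cube_average:
  assumes i: "i \<in> {1..r}" and g: "g \<in> borel_measurable (cube_prob r)"
  shows "(\<integral>\<^sup>+ x. g x \<partial>cube_prob r) = (\<integral>\<^sup>+ x. (\<integral>\<^sup>+ t. g (x(i := t)) \<partial>unif) \<partial>cube_prob r)"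
proof -
  define I where "I = {1..r} - {i}"
  have I: "{1..r} = insert i I" "finite I" "i \<notin> I" using i by (auto simp: I_def)
  have av: "(\<lambda>x. \<integral>\<^sup>+ t. g (x(i := t)) \<partial>unif) \<in> borel_measurable (cube_prob r)"
    using measurable_compose[OF measurable_cube_upd[OF i] g]
    by (intro unif.borel_measurable_nn_integral) (simp add: split_def)
  have "(\<integral>\<^sup>+ x. (\<integral>\<^sup>+ t. g (x(i := t)) \<partial>unif) \<partial>cube_prob r)
      = (\<integral>\<^sup>+ x. (\<integral>\<^sup>+ y. (\<integral>\<^sup>+ t. g ((x(i := y))(i := t)) \<partial>unif) \<partial>unif) \<partial>Pi\<^sub>M I (\<lambda>_. unif))"
    using av I unfolding cube_prob_def
    by (simp del: fun_upd_upd add: unifs.product_nn_integral_insert)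
  also have "\<dots> = (\<integral>\<^sup>+ x. (\<integral>\<^sup>+ t. g (x(i := t)) \<partial>unif) \<partial>Pi\<^sub>M I (\<lambda>_. unif))"
    using unif.emeasure_space_1 by simp
  also have "\<dots> = (\<integral>\<^sup>+ x. g x \<partial>cube_prob r)"
    using g I unfolding cube_prob_def by (simp add: unifs.product_nn_integral_insert)
  finally show ?thesis by simp
qed

lemma nn_integral_cube_prod:
  assumes "\<And>i. i \<in> {1..r} \<Longrightarrow> g i \<in> borel_measurable borel"
  shows "(\<integral>\<^sup>+ x. (\<Prod>i\<in>{1..r}. g i (x i)) \<partial>cube_prob r) = (\<Prod>i\<in>{1..r}. \<integral>\<^sup>+ t. g i t \<partial>unif)"
  unfolding cube_prob_def using assms
  by (intro unifs.product_nn_integral_prod) (auto cong: measurable_cong_sets)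

text \<open>The counterpart of \<open>mixed_integral\<close> for extended nonnegative integrands and
  free exponents, so that \<open>q = (\<lambda>_. 1)\<close> gives the ordinary integral. The factor
  2 undoes the normalisation of \<open>unif\<close>; \<open>q j\<close> acts on stage
  \<open>j\<close> before coordinate \<open>Suc j\<close> is integrated.\<close>

fun mixint :: "(nat \<Rightarrow> real) \<Rightarrow> ((nat \<Rightarrow> real) \<Rightarrow> ennreal) \<Rightarrow> nat \<Rightarrow> (nat \<Rightarrow> real) \<Rightarrow> ennreal" where
  "mixint q u 0 x = u x"
| "mixint q u (Suc j) x = 2 * (\<integral>\<^sup>+ t. ennreal_powr (mixint q u j (x(Suc j := t))) (q j) \<partial>unif)"

lemma mixint_0' [simp]: "mixint q u 0 = u"
  by (rule ext) simp

lemma measurable_mixint: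
  "u \<in> borel_measurable (cube_prob r) \<Longrightarrow> j \<le> r \<Longrightarrow> mixint q u j \<in> borel_measurable (cube_prob r)"
proof (induction j)
  case (Suc j)
  then have "mixint q u j \<in> borel_measurable (cube_prob r)" by simp
  from measurable_compose[OF measurable_cube_upd this, of "Suc j"] Suc.prems
  show ?case
    by (auto simp: split_def intro!: unif.borel_measurable_nn_integral borel_measurable_times_ennreal measurable_ennreal_powr)
qed simp

lemma measurable_mixint_section:
  assumes "u \<in> borel_measurable (cube_prob r)" "Suc j \<le> r" "x \<in> space (cube_prob r)"
  shows "(\<lambda>t. mixint q u j (x(Suc j := t))) \<in> borel_measurable unif"
  using measurable_compose[OF measurable_cube_upd_const[of x r "Suc j"] measurable_mixint[of u r j q]]
    assms by (auto cong: measurable_cong_sets)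

lemma mixint_local:
  assumes "\<And>i. i \<notin> {1..j} \<Longrightarrow> x i = y i"
  shows "mixint q u j x = mixint q u j y"
  using assms
proof (induction j arbitrary: x y)
  case 0
  then have "x = y" by auto
  then show ?case by simp
next
  case (Suc j)
  have "mixint q u j (x(Suc j := t)) = mixint q u j (y(Suc j := t))" for t
    by (rule Suc.IH) (use Suc.prems in auto)
  then show ?case by simp
qed

lemma mixint_top_const:
  "x \<in> space (cube_prob r) \<Longrightarrow> y \<in> space (cube_prob r) \<Longrightarrow> mixint q u r x = mixint q u r y"
  by (rule mixint_local) (auto simp: space_cube_prob PiE_def extensional_def)

lemma mixint_mono:
  assumes "\<And>y. y \<in> space (cube_prob r) \<Longrightarrow> u y \<le> v y" "\<And>i. i < j \<Longrightarrow> 0 \<le> q i"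
    and "j \<le> r" "x \<in> space (cube_prob r)"
  shows "mixint q u j x \<le> mixint q v j x"
  using assms(2-)
proof (induction j arbitrary: x)
  case (Suc j)
  then have "mixint q u j (x(Suc j := t)) \<le> mixint q v j (x(Suc j := t))" for t
    by (intro Suc.IH cube_upd_in_space) auto
  with Suc.prems show ?case
    by (auto intro!: mult_left_mono nn_integral_mono ennreal_powr_mono)
qed (simp add: assms(1))

text \<open>A substitute for the triangle inequality before any root is taken. The constant is
  chosen before \<open>u\<close> and \<open>v\<close>; each stage raises it to the power
  \<open>q j\<close> and multiplies it by \<open>2 powr q j\<close>.\<close>

lemma mixint_add:
  assumes "\<And>i. i < j \<Longrightarrow> 0 \<le> q i" "j \<le> r"
  shows "\<exists>c<\<top>. \<forall>u\<in>borel_measurable (cube_prob r). \<forall>v\<in>borel_measurable (cube_prob r).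
           \<forall>x\<in>space (cube_prob r). mixint q (\<lambda>y. u y + v y) j x \<le> c * (mixint q u j x + mixint q v j x)"
  using assms
proof (induction j)
  case 0
  then show ?case by (intro exI[of _ 1]) auto
next
  case (Suc j)
  have "j \<le> r" "\<And>i. i < j \<Longrightarrow> 0 \<le> q i" using Suc.prems by auto
  from Suc.IH[OF this(2,1)] obtain c where c: "c < \<top>" "\<And>u v x. u \<in> borel_measurable (cube_prob r) \<Longrightarrow>
      v \<in> borel_measurable (cube_prob r) \<Longrightarrow> x \<in> space (cube_prob r) \<Longrightarrow>
      mixint q (\<lambda>y. u y + v y) j x \<le> c * (mixint q u j x + mixint q v j x)"
    by auto
  define d where "d = ennreal_powr c (q j) * ennreal (2 powr q j)"
  have d: "d < \<top>" using c(1) by (simp add: d_def ennreal_mult_less_top ennreal_powr_less_top_iff)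
  have qj: "0 \<le> q j" using Suc.prems by simp
  show ?case
  proof (intro exI[of _ d] conjI ballI d)
    fix u v :: "(nat \<Rightarrow> real) \<Rightarrow> ennreal" and x assume u: "u \<in> borel_measurable (cube_prob r)" and v: "v \<in> borel_measurable (cube_prob r)"
      and x: "x \<in> space (cube_prob r)"
    note [measurable] = measurable_mixint_section[OF u Suc.prems(2) x, of q]
      measurable_mixint_section[OF v Suc.prems(2) x, of q]
    have "ennreal_powr (mixint q (\<lambda>y. u y + v y) j (x(Suc j := t))) (q j)
        \<le> d * (ennreal_powr (mixint q u j (x(Suc j := t))) (q j) + ennreal_powr (mixint q v j (x(Suc j := t))) (q j))" for t
    proof -
      have "ennreal_powr (mixint q (\<lambda>y. u y + v y) j (x(Suc j := t))) (q j)
        \<le> ennreal_powr (c * (mixint q u j (x(Suc j := t)) + mixint q v j (x(Suc j := t)))) (q j)"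
        using u v x Suc.prems by (intro ennreal_powr_mono c qj cube_upd_in_space) auto
      also have "\<dots> = ennreal_powr c (q j) * ennreal_powr (mixint q u j (x(Suc j := t)) + mixint q v j (x(Suc j := t))) (q j)"
        using c(1) by (rule ennreal_powr_mult)
      also have "\<dots> \<le> ennreal_powr c (q j) * (ennreal (2 powr q j) * (ennreal_powr (mixint q u j (x(Suc j := t))) (q j) + ennreal_powr (mixint q v j (x(Suc j := t))) (q j)))"
        by (intro mult_left_mono ennreal_powr_add_le qj) auto
      finally show ?thesis by (simp add: d_def mult.assoc)
    qed
    then have "mixint q (\<lambda>y. u y + v y) (Suc j) x \<le> 2 * (\<integral>\<^sup>+ t. d * (ennreal_powr (mixint q u j (x(Suc j := t))) (q j) + ennreal_powr (mixint q v j (x(Suc j := t))) (q j)) \<partial>unif)"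
      by (auto intro!: mult_left_mono nn_integral_mono)
    also have "\<dots> = d * (mixint q u (Suc j) x + mixint q v (Suc j) x)"
      by (simp add: nn_integral_cmult nn_integral_add distrib_left mult.left_commute)
    finally show "mixint q (\<lambda>y. u y + v y) (Suc j) x \<le> d * (mixint q u (Suc j) x + mixint q v (Suc j) x)" .
  qed
qed

text \<open>A pointwise bound \<open>B'\<close> is carried along with the linear bound, because
  linearising the power at the next stage needs a bound on the current one. Both constants depend on
  \<open>B\<close> but not on \<open>u\<close>.\<close>

lemma mixint_le_linear:
  assumes "\<And>i. i < j \<Longrightarrow> 1 \<le> q i" "j \<le> r" "0 \<le> B"
  shows "\<exists>c<\<top>. \<exists>B'\<ge>0. \<forall>u\<in>borel_measurable (cube_prob r). (\<forall>x\<in>space (cube_prob r). u x \<le> ennreal B) \<longrightarrow>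
           (\<forall>x\<in>space (cube_prob r). mixint q u j x \<le> ennreal B' \<and> mixint q u j x \<le> c * mixint (\<lambda>_. 1) u j x)"
  using assms(1,2)
proof (induction j)
  case 0
  then show ?case using assms(3) by (intro exI[of _ 1] exI[of _ B] conjI) auto
next
  case (Suc j)
  have "j \<le> r" "\<And>i. i < j \<Longrightarrow> 1 \<le> q i" using Suc.prems by auto
  from Suc.IH[OF this(2,1)] obtain c B' where c: "c < \<top>" "0 \<le> B'" "\<And>u x. u \<in> borel_measurable (cube_prob r) \<Longrightarrow>
      (\<forall>x\<in>space (cube_prob r). u x \<le> ennreal B) \<Longrightarrow> x \<in> space (cube_prob r) \<Longrightarrow>
      mixint q u j x \<le> ennreal B' \<and> mixint q u j x \<le> c * mixint (\<lambda>_. 1) u j x"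
    by blast
  define d where "d = ennreal (B' powr (q j - 1)) * c"
  have d: "d < \<top>" using c(1) by (simp add: d_def ennreal_mult_less_top)
  have qj: "1 \<le> q j" using Suc.prems by simp
  show ?case
  \<comment> \<open>The next pointwise bound is the integral of \<open>B' powr q j\<close> over an
    interval of length 2.\<close>
  proof (intro exI[of _ d] exI[of _ "2 * B' powr q j"] conjI ballI d impI)
    fix u :: "(nat \<Rightarrow> real) \<Rightarrow> ennreal" and x assume u: "u \<in> borel_measurable (cube_prob r)" and B: "\<forall>x\<in>space (cube_prob r). u x \<le> ennreal B"
      and x: "x \<in> space (cube_prob r)"
    note [measurable] = measurable_mixint_section[OF u Suc.prems(2) x]
    have IH: "mixint q u j (x(Suc j := t)) \<le> ennreal B'"
      "mixint q u j (x(Suc j := t)) \<le> c * mixint (\<lambda>_. 1) u j (x(Suc j := t))" for t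
      using c(3)[OF u B cube_upd_in_space[OF x]] Suc.prems by auto
    have "(\<integral>\<^sup>+ t. ennreal_powr (mixint q u j (x(Suc j := t))) (q j) \<partial>unif) \<le> (\<integral>\<^sup>+ t. ennreal (B' powr q j) \<partial>unif)"
    proof (intro nn_integral_mono)
      fix t
      have "ennreal_powr (mixint q u j (x(Suc j := t))) (q j) \<le> ennreal_powr (ennreal B') (q j)"
        using qj by (intro ennreal_powr_mono IH) auto
      then show "ennreal_powr (mixint q u j (x(Suc j := t))) (q j) \<le> ennreal (B' powr q j)"
        using c(2) by (simp add: ennreal_powr_of_ennreal)
    qed
    then have "mixint q u (Suc j) x \<le> 2 * ennreal (B' powr q j)"
      using unif.emeasure_space_1 by (auto intro!: mult_left_mono)
    then show "mixint q u (Suc j) x \<le> ennreal (2 * B' powr q j)"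
      by (simp add: ennreal_mult')
    have "(\<integral>\<^sup>+ t. ennreal_powr (mixint q u j (x(Suc j := t))) (q j) \<partial>unif) \<le> (\<integral>\<^sup>+ t. d * mixint (\<lambda>_. 1) u j (x(Suc j := t)) \<partial>unif)"
    proof (intro nn_integral_mono)
      fix t
      have "ennreal_powr (mixint q u j (x(Suc j := t))) (q j) \<le> ennreal (B' powr (q j - 1)) * mixint q u j (x(Suc j := t))"
        by (intro ennreal_powr_le_linear IH qj c)
      also have "\<dots> \<le> ennreal (B' powr (q j - 1)) * (c * mixint (\<lambda>_. 1) u j (x(Suc j := t)))"
        by (intro mult_left_mono IH) auto
      finally show "ennreal_powr (mixint q u j (x(Suc j := t))) (q j) \<le> d * mixint (\<lambda>_. 1) u j (x(Suc j := t))"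
        by (simp add: d_def mult.assoc)
    qed
    also have "\<dots> = d * (\<integral>\<^sup>+ t. mixint (\<lambda>_. 1) u j (x(Suc j := t)) \<partial>unif)"
      by (simp add: nn_integral_cmult)
    finally show "mixint q u (Suc j) x \<le> d * mixint (\<lambda>_. 1) u (Suc j) x"
      by (simp add: mult.left_commute[of d] mult_left_mono)
  qed simp
qed

text \<open>Tonelli's theorem. The intermediate stages still depend on the outer coordinates, so the
  induction compares their integrals over the whole cube; the last stage is constant and can be read
  off.\<close>

lemma mixint_1_top:
  assumes u: "u \<in> borel_measurable (cube_prob r)" and x: "x \<in> space (cube_prob r)"
  shows "mixint (\<lambda>_. 1) u r x = 2 ^ r * (\<integral>\<^sup>+ y. u y \<partial>cube_prob r)"
proof -
  have "j \<le> r \<Longrightarrow> (\<integral>\<^sup>+ y. mixint (\<lambda>_. 1) u j y \<partial>cube_prob r) = 2 ^ j * (\<integral>\<^sup>+ y. u y \<partial>cube_prob r)" for j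
  proof (induction j)
    case (Suc j)
    have m: "mixint (\<lambda>_. 1) u j \<in> borel_measurable (cube_prob r)"
      using u Suc.prems by (intro measurable_mixint) auto
    from measurable_compose[OF measurable_cube_upd this, of "Suc j"] Suc.prems
    have av: "(\<lambda>y. \<integral>\<^sup>+ t. mixint (\<lambda>_. 1) u j (y(Suc j := t)) \<partial>unif) \<in> borel_measurable (cube_prob r)"
      by (intro unif.borel_measurable_nn_integral) (simp add: split_def)
    have "(\<integral>\<^sup>+ y. mixint (\<lambda>_. 1) u (Suc j) y \<partial>cube_prob r)
        = 2 * (\<integral>\<^sup>+ y. (\<integral>\<^sup>+ t. mixint (\<lambda>_. 1) u j (y(Suc j := t)) \<partial>unif) \<partial>cube_prob r)"
      using av by (simp add: nn_integral_cmult)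
    also have "\<dots> = 2 * (\<integral>\<^sup>+ y. mixint (\<lambda>_. 1) u j y \<partial>cube_prob r)"
      using m Suc.prems by (subst nn_integral_cube_average[of "Suc j", symmetric]) auto
    finally show ?case using Suc by (simp add: mult.assoc)
  qed simp
  from this[of r] have "(\<integral>\<^sup>+ y. mixint (\<lambda>_. 1) u r y \<partial>cube_prob r) = 2 ^ r * (\<integral>\<^sup>+ y. u y \<partial>cube_prob r)"
    by simp
  moreover have "(\<integral>\<^sup>+ y. mixint (\<lambda>_. 1) u r y \<partial>cube_prob r) = (\<integral>\<^sup>+ y. mixint (\<lambda>_. 1) u r x \<partial>cube_prob r)"
    using x by (intro nn_integral_cong mixint_top_const) auto
  ultimately show ?thesis using cube.emeasure_space_1[of r] by simp
qed

text \<open>Dominated convergence at every stage, with the stages of \<open>w\<close> as majorants.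
  Finiteness of one stage gives finiteness of the previous one only for almost every
  \<open>t\<close>, so the induction is run at those points \<open>x\<close> where the stage of
  \<open>w\<close> is finite.\<close>

lemma mixint_tendsto_0:
  assumes w: "w \<in> borel_measurable (cube_prob r)" and u: "\<And>n::nat. u n \<in> borel_measurable (cube_prob r)"
    and le: "\<And>n y. y \<in> space (cube_prob r) \<Longrightarrow> u n y \<le> w y"
    and lim: "\<And>y. y \<in> space (cube_prob r) \<Longrightarrow> (\<lambda>n. u n y) \<longlonglongrightarrow> 0"
    and "\<And>i. i < j \<Longrightarrow> 0 < q i" "j \<le> r" "x \<in> space (cube_prob r)" "mixint q w j x < \<top>"
  shows "(\<lambda>n. mixint q (u n) j x) \<longlonglongrightarrow> 0"
  using assms(5-)
proof (induction j arbitrary: x)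
  case (Suc j)
  note [measurable] = measurable_mixint_section[OF u Suc.prems(2,3), of q]
    measurable_mixint_section[OF w Suc.prems(2,3), of q]
  have upd: "x(Suc j := t) \<in> space (cube_prob r)" for t
    using Suc.prems by (intro cube_upd_in_space) auto
  have fin: "(\<integral>\<^sup>+ t. ennreal_powr (mixint q w j (x(Suc j := t))) (q j) \<partial>unif) < \<top>"
    using Suc.prems(4) by (auto simp: ennreal_mult_less_top)
  then have "AE t in unif. ennreal_powr (mixint q w j (x(Suc j := t))) (q j) \<noteq> \<infinity>"
    by (intro nn_integral_PInf_AE) (auto simp: less_top)
  then have "AE t in unif. (\<lambda>n. ennreal_powr (mixint q (u n) j (x(Suc j := t))) (q j)) \<longlonglongrightarrow> 0"
  proof eventually_elim
    case (elim t)
    then have "mixint q w j (x(Suc j := t)) < \<top>" by (simp add: less_top del: fun_upd_apply)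
    with Suc.prems upd show ?case by (intro tendsto_ennreal_powr_0 Suc.IH) (auto simp del: fun_upd_apply)
  qed
  then have "(\<lambda>n. \<integral>\<^sup>+ t. ennreal_powr (mixint q (u n) j (x(Suc j := t))) (q j) \<partial>unif) \<longlonglongrightarrow> (\<integral>\<^sup>+ t. 0 \<partial>unif)"
  proof (intro nn_integral_dominated_convergence[where w="\<lambda>t. ennreal_powr (mixint q w j (x(Suc j := t))) (q j)"])
    fix n
    have "0 \<le> q i" if "i < Suc j" for i
      using Suc.prems(1)[OF that] by simp
    then show "AE t in unif. ennreal_powr (mixint q (u n) j (x(Suc j := t))) (q j)
        \<le> ennreal_powr (mixint q w j (x(Suc j := t))) (q j)"
      using Suc.prems(2) upd le by (intro AE_I2 ennreal_powr_mono mixint_mono[of r]) auto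
  qed (use fin in auto)
  then show ?case
    using tendsto_mult_ennreal[OF tendsto_const[of 2]] by fastforce
qed (simp add: lim)

section \<open>Averaging kernels\<close>

lemma prod_mono_ennreal:
  fixes f g :: "'a \<Rightarrow> ennreal"
  shows "(\<And>i. i \<in> A \<Longrightarrow> f i \<le> g i) \<Longrightarrow> prod f A \<le> prod g A"
  by (induction A rule: infinite_finite_induct) (auto intro!: mult_mono)

text \<open>\<open>k x\<close> is a density with respect to \<open>unif\<close>. The row condition
  makes it a probability density, as Jensen's inequality requires; it is imposed at every real
  \<open>x\<close> because the space of \<open>unif\<close> is the whole line.\<close>

locale averaging_kernel =
  fixes k :: "real \<Rightarrow> real \<Rightarrow> ennreal" and C :: ennreal
  assumes measurable_kernel [measurable]: "case_prod k \<in> borel_measurable (borel \<Otimes>\<^sub>M borel)"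
    and row_mass: "\<And>x. (\<integral>\<^sup>+ t. k x t \<partial>unif) = 1"
    and column_mass: "\<And>t. (\<integral>\<^sup>+ x. k x t \<partial>unif) \<le> C"
begin

text \<open>The kernel that remains once the first \<open>j\<close> coordinates of \<open>x\<close>
  have been integrated: their factors are replaced by 1. It is the full tensor product at
  \<open>j = 0\<close> and constantly 1 at \<open>j = r\<close>.\<close>

definition prod_kernel :: "nat \<Rightarrow> nat \<Rightarrow> (nat \<Rightarrow> real) \<Rightarrow> (nat \<Rightarrow> real) \<Rightarrow> ennreal" where
  "prod_kernel r j x t = (\<Prod>i\<in>{1..r}. if i \<le> j then 1 else k (x i) (t i))"

lemma measurable_kernel_comp [measurable (raw)]:
  "f \<in> borel_measurable M \<Longrightarrow> g \<in> borel_measurable M \<Longrightarrow> (\<lambda>z. k (f z) (g z)) \<in> borel_measurable M"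
  using measurable_compose[OF measurable_Pair measurable_kernel, of f M g] by simp

lemma measurable_prod_kernel_comp [measurable (raw)]:
  assumes f: "f \<in> M \<rightarrow>\<^sub>M cube_prob r" and g: "g \<in> M \<rightarrow>\<^sub>M cube_prob r"
  shows "(\<lambda>z. prod_kernel r j (f z) (g z)) \<in> borel_measurable M"
  unfolding prod_kernel_def
proof (intro borel_measurable_prod_ennreal)
  fix i assume "i \<in> {1..r}"
  note [measurable] = measurable_compose[OF f measurable_cube_component[OF this]]
    measurable_compose[OF g measurable_cube_component[OF this]]
  show "(\<lambda>z. if i \<le> j then 1 else k (f z i) (g z i)) \<in> borel_measurable M"
    by simp
qed

lemma prod_kernel_row_mass: "(\<integral>\<^sup>+ t. prod_kernel r j x t \<partial>cube_prob r) = 1"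
proof -
  have "(\<integral>\<^sup>+ t. prod_kernel r j x t \<partial>cube_prob r)
      = (\<Prod>i\<in>{1..r}. \<integral>\<^sup>+ s. (if i \<le> j then 1 else k (x i) s) \<partial>unif)"
    unfolding prod_kernel_def by (rule nn_integral_cube_prod) simp
  also have "\<dots> = 1"
  proof (intro prod.neutral ballI)
    fix i
    show "(\<integral>\<^sup>+ s. (if i \<le> j then 1 else k (x i) s) \<partial>unif) = 1"
      using unif.emeasure_space_1 by (cases "i \<le> j") (auto simp: row_mass)
  qed
  finally show ?thesis .
qed

lemma prod_kernel_column_mass: "(\<integral>\<^sup>+ x. prod_kernel r 0 x t \<partial>cube_prob r) \<le> C ^ r"
proof -
  have "(\<integral>\<^sup>+ x. prod_kernel r 0 x t \<partial>cube_prob r)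
      = (\<Prod>i\<in>{1..r}. \<integral>\<^sup>+ s. (if i \<le> 0 then 1 else k s (t i)) \<partial>unif)"
    unfolding prod_kernel_def by (rule nn_integral_cube_prod) simp
  also have "\<dots> \<le> (\<Prod>i\<in>{1..r}. C)"
    by (intro prod_mono_ennreal) (auto simp: column_mass)
  finally show ?thesis by simp
qed

text \<open>The updated variable occurs in a single factor. Splitting it off exposes the factor to
  which the column bound applies.\<close>

lemma prod_kernel_upd_left:
  assumes "Suc j \<le> r"
  shows "prod_kernel r j (x(Suc j := s)) t = k s (t (Suc j)) * prod_kernel r (Suc j) x t"
proof -
  have "prod_kernel r j (x(Suc j := s)) t
      = (\<Prod>i\<in>{1..r}. (if i = Suc j then k s (t (Suc j)) else 1) * (if i \<le> Suc j then 1 else k (x i) (t i)))"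
    unfolding prod_kernel_def by (intro prod.cong) (auto simp: le_Suc_eq)
  also have "\<dots> = k s (t (Suc j)) * prod_kernel r (Suc j) x t"
    using assms by (simp add: prod.distrib prod_kernel_def)
  finally show ?thesis .
qed

lemma prod_kernel_upd_right: "prod_kernel r (Suc j) x (t(Suc j := s)) = prod_kernel r (Suc j) x t"
  unfolding prod_kernel_def by (intro prod.cong) auto

lemma prod_kernel_top: "prod_kernel r r x t = 1"
  unfolding prod_kernel_def by (intro prod.neutral) auto

definition average :: "nat \<Rightarrow> ((nat \<Rightarrow> real) \<Rightarrow> ennreal) \<Rightarrow> (nat \<Rightarrow> real) \<Rightarrow> ennreal" where
  "average r u x = (\<integral>\<^sup>+ t. prod_kernel r 0 x t * u t \<partial>cube_prob r)"

text \<open>The mean of \<open>\<bar>f t - f x\<bar>\<close> when \<open>x\<close> is uniform on the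
  cube and \<open>t\<close> is drawn from the kernel at \<open>x\<close>. It depends on increments
  alone, so indicators of complementary sets have the same dispersion.\<close>

definition dispersion :: "nat \<Rightarrow> ((nat \<Rightarrow> real) \<Rightarrow> real) \<Rightarrow> ennreal" where
  "dispersion r f = (\<integral>\<^sup>+ x. average r (\<lambda>t. ennreal \<bar>f t - f x\<bar>) x \<partial>cube_prob r)"

lemma measurable_average_pair [measurable (raw)]:
  assumes [measurable]: "(\<lambda>z. u (fst z) (snd z)) \<in> borel_measurable (cube_prob r \<Otimes>\<^sub>M cube_prob r)"
  shows "(\<lambda>x. average r (u x) x) \<in> borel_measurable (cube_prob r)"
proof -
  have "(\<lambda>z. prod_kernel r 0 (fst z) (snd z) * u (fst z) (snd z)) \<in> borel_measurable (cube_prob r \<Otimes>\<^sub>M cube_prob r)"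
    by measurable
  then show ?thesis
    unfolding average_def by (intro cube.borel_measurable_nn_integral) (simp add: split_def)
qed

text \<open>The remaining kernel still has row mass 1 at every stage, which lets Jensen's inequality
  be applied to it again. Each step costs the power \<open>q j\<close> of the old constant and one
  factor \<open>C\<close>.\<close>

lemma mixint_average_step:
  assumes u: "u \<in> borel_measurable (cube_prob r)" and j: "Suc j \<le> r" and q: "1 \<le> q j"
    and c: "c < \<top>" and x: "x \<in> space (cube_prob r)"
    and IH: "\<And>x. x \<in> space (cube_prob r) \<Longrightarrow>
      mixint q (average r u) j x \<le> c * (\<integral>\<^sup>+ t. prod_kernel r j x t * mixint q u j t \<partial>cube_prob r)"
  shows "mixint q (average r u) (Suc j) x
    \<le> (ennreal_powr c (q j) * C) * (\<integral>\<^sup>+ t. prod_kernel r (Suc j) x t * mixint q u (Suc j) t \<partial>cube_prob r)"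
proof -
  let ?h = "\<lambda>t. ennreal_powr (mixint q u j t) (q j)"
  have m: "mixint q u j \<in> borel_measurable (cube_prob r)"
    using u j by (intro measurable_mixint) auto
  note [measurable] = m
  have Sj: "Suc j \<in> {1..r}" using j by simp
  have x_const: "(\<lambda>z. x) \<in> M \<rightarrow>\<^sub>M cube_prob r" for M :: "'a measure"
    using x by simp
  have [measurable]: "prod_kernel r i y \<in> borel_measurable (cube_prob r)"
    if "y \<in> space (cube_prob r)" for i y
    by (rule measurable_prod_kernel_comp) (use that in auto)
  note [measurable] = measurable_cube_component[OF Sj]
  have upd: "x(Suc j := s) \<in> space (cube_prob r)" for s
    using x Sj by (rule cube_upd_in_space)
  have "mixint q (average r u) (Suc j) x
      \<le> 2 * (\<integral>\<^sup>+ s. ennreal_powr c (q j) * (\<integral>\<^sup>+ t. prod_kernel r j (x(Suc j := s)) t * ?h t \<partial>cube_prob r) \<partial>unif)"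
  proof -
    have "ennreal_powr (mixint q (average r u) j (x(Suc j := s))) (q j)
        \<le> ennreal_powr c (q j) * (\<integral>\<^sup>+ t. prod_kernel r j (x(Suc j := s)) t * ?h t \<partial>cube_prob r)" for s
    proof -
      have "ennreal_powr (mixint q (average r u) j (x(Suc j := s))) (q j)
          \<le> ennreal_powr (c * (\<integral>\<^sup>+ t. prod_kernel r j (x(Suc j := s)) t * mixint q u j t \<partial>cube_prob r)) (q j)"
        using q by (intro ennreal_powr_mono IH upd) auto
      also have "\<dots> = ennreal_powr c (q j) *
          ennreal_powr (\<integral>\<^sup>+ t. prod_kernel r j (x(Suc j := s)) t * mixint q u j t \<partial>cube_prob r) (q j)"
        using c by (rule ennreal_powr_mult)
      also have "\<dots> \<le> ennreal_powr c (q j) * (\<integral>\<^sup>+ t. prod_kernel r j (x(Suc j := s)) t * ?h t \<partial>cube_prob r)"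
        using upd[of s] q by (intro mult_left_mono ennreal_powr_Jensen) (auto simp: prod_kernel_row_mass)
      finally show ?thesis .
    qed
    then show ?thesis by (auto intro!: mult_left_mono nn_integral_mono)
  qed
  also have "(\<integral>\<^sup>+ s. ennreal_powr c (q j) * (\<integral>\<^sup>+ t. prod_kernel r j (x(Suc j := s)) t * ?h t \<partial>cube_prob r) \<partial>unif)
      = (\<integral>\<^sup>+ s. (\<integral>\<^sup>+ t. ennreal_powr c (q j) * (k s (t (Suc j)) * prod_kernel r (Suc j) x t * ?h t) \<partial>cube_prob r) \<partial>unif)"
    using upd x j by (subst nn_integral_cmult[symmetric]) (auto simp: prod_kernel_upd_left simp del: fun_upd_apply)
  also have "\<dots> = (\<integral>\<^sup>+ t. (\<integral>\<^sup>+ s. ennreal_powr c (q j) * (k s (t (Suc j)) * prod_kernel r (Suc j) x t * ?h t) \<partial>unif) \<partial>cube_prob r)"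
  proof (rule pair_sigma_finite.Fubini')
    show "pair_sigma_finite (cube_prob r) unif"
      by (simp add: pair_sigma_finite_def cube.sigma_finite_measure_axioms unif.sigma_finite_measure_axioms)
    show "(\<lambda>(t, s). ennreal_powr c (q j) * (k s (t (Suc j)) * prod_kernel r (Suc j) x t * ?h t))
        \<in> borel_measurable (cube_prob r \<Otimes>\<^sub>M unif)"
      using x by measurable
  qed
  also have "\<dots> = (\<integral>\<^sup>+ t. ennreal_powr c (q j) * ((\<integral>\<^sup>+ s. k s (t (Suc j)) \<partial>unif) * (prod_kernel r (Suc j) x t * ?h t)) \<partial>cube_prob r)"
  proof (intro nn_integral_cong)
    fix t
    have "(\<lambda>s. k s (t (Suc j))) \<in> borel_measurable unif"
      by (intro measurable_kernel_comp measurable_const) (auto cong: measurable_cong_sets)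
    then show "(\<integral>\<^sup>+ s. ennreal_powr c (q j) * (k s (t (Suc j)) * prod_kernel r (Suc j) x t * ?h t) \<partial>unif)
        = ennreal_powr c (q j) * ((\<integral>\<^sup>+ s. k s (t (Suc j)) \<partial>unif) * (prod_kernel r (Suc j) x t * ?h t))"
      by (simp add: nn_integral_cmult nn_integral_multc mult.assoc)
  qed
  also have "\<dots> \<le> (\<integral>\<^sup>+ t. ennreal_powr c (q j) * (C * (prod_kernel r (Suc j) x t * ?h t)) \<partial>cube_prob r)"
    by (intro nn_integral_mono mult_left_mono mult_right_mono column_mass) auto
  also have "\<dots> = ennreal_powr c (q j) * C * (\<integral>\<^sup>+ t. prod_kernel r (Suc j) x t * ?h t \<partial>cube_prob r)"
    using x by (simp add: nn_integral_cmult mult.assoc)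
  \<comment> \<open>The remaining kernel is constant in coordinate \<open>Suc j\<close> of
    \<open>t\<close>. Averaging the integrand over that coordinate is therefore free and produces
    the next stage of \<open>mixint q u\<close>.\<close>
  also have "(\<integral>\<^sup>+ t. prod_kernel r (Suc j) x t * ?h t \<partial>cube_prob r)
      = (\<integral>\<^sup>+ t. (\<integral>\<^sup>+ s. prod_kernel r (Suc j) x t * ?h (t(Suc j := s)) \<partial>unif) \<partial>cube_prob r)"
    using x by (subst nn_integral_cube_average[OF Sj]) (auto simp: prod_kernel_upd_right simp del: fun_upd_apply)
  also have "\<dots> = (\<integral>\<^sup>+ t. prod_kernel r (Suc j) x t * (\<integral>\<^sup>+ s. ?h (t(Suc j := s)) \<partial>unif) \<partial>cube_prob r)"
    using measurable_mixint_section[OF u j, of _ q]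
    by (intro nn_integral_cong nn_integral_cmult) auto
  finally have *: "mixint q (average r u) (Suc j) x \<le> 2 * (ennreal_powr c (q j) * C *
      (\<integral>\<^sup>+ t. prod_kernel r (Suc j) x t * (\<integral>\<^sup>+ s. ?h (t(Suc j := s)) \<partial>unif) \<partial>cube_prob r))"
    by (simp add: mult_left_mono)
  have [measurable]: "(\<lambda>t. \<integral>\<^sup>+ s. ?h (t(Suc j := s)) \<partial>unif) \<in> borel_measurable (cube_prob r)"
    using measurable_compose[OF measurable_cube_upd[OF Sj] m]
    by (intro unif.borel_measurable_nn_integral) (simp add: split_def measurable_ennreal_powr)
  have "(\<integral>\<^sup>+ t. prod_kernel r (Suc j) x t * mixint q u (Suc j) t \<partial>cube_prob r)
      = 2 * (\<integral>\<^sup>+ t. prod_kernel r (Suc j) x t * (\<integral>\<^sup>+ s. ?h (t(Suc j := s)) \<partial>unif) \<partial>cube_prob r)"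
    using x by (subst nn_integral_cmult[symmetric]) (auto simp: mult.left_commute)
  with * show ?thesis
    by (simp only: mult_ac)
qed

end

text \<open>The constant is fixed before the kernel, hence serves all kernels with column bound
  \<open>C\<close> at once. For this reason the statement stands outside the locale.\<close>

lemma mixint_average_le:
  assumes "C < \<top>" "\<And>i. i < j \<Longrightarrow> 1 \<le> q i" "j \<le> r"
  shows "\<exists>c<\<top>. \<forall>k. averaging_kernel k C \<longrightarrow> (\<forall>u\<in>borel_measurable (cube_prob r). \<forall>x\<in>space (cube_prob r).
    mixint q (averaging_kernel.average k r u) j x
      \<le> c * (\<integral>\<^sup>+ t. averaging_kernel.prod_kernel k r j x t * mixint q u j t \<partial>cube_prob r))"
  using assms(2,3)
proof (induction j)
  case 0
  show ?case
    by (intro exI[of _ 1]) (auto simp: averaging_kernel.average_def)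
next
  case (Suc j)
  have "j \<le> r" "\<And>i. i < j \<Longrightarrow> 1 \<le> q i" using Suc.prems by auto
  from Suc.IH[OF this(2,1)] obtain c where c: "c < \<top>"
    and IH: "\<And>k u x. averaging_kernel k C \<Longrightarrow> u \<in> borel_measurable (cube_prob r) \<Longrightarrow> x \<in> space (cube_prob r) \<Longrightarrow>
      mixint q (averaging_kernel.average k r u) j x
      \<le> c * (\<integral>\<^sup>+ t. averaging_kernel.prod_kernel k r j x t * mixint q u j t \<partial>cube_prob r)"
    by auto
  show ?case
  proof (intro exI[of _ "ennreal_powr c (q j) * C"] conjI allI impI ballI)
    show "ennreal_powr c (q j) * C < \<top>"
      using c assms(1) by (simp add: ennreal_mult_less_top ennreal_powr_less_top_iff)
    fix k x and u :: "(nat \<Rightarrow> real) \<Rightarrow> ennreal"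
    assume "averaging_kernel k C" "u \<in> borel_measurable (cube_prob r)" "x \<in> space (cube_prob r)"
    then show "mixint q (averaging_kernel.average k r u) (Suc j) x \<le> (ennreal_powr c (q j) * C) *
        (\<integral>\<^sup>+ t. averaging_kernel.prod_kernel k r (Suc j) x t * mixint q u (Suc j) t \<partial>cube_prob r)"
      using Suc.prems c by (intro averaging_kernel.mixint_average_step IH) auto
  qed
qed

text \<open>After all \<open>r\<close> stages no kernel factor is left and the iterated integral of
  \<open>u\<close> is constant, so its mean over the cube is its value at \<open>x\<close>.\<close>

lemma mixint_average_bound:
  assumes "C < \<top>" "\<And>i. i < r \<Longrightarrow> 1 \<le> q i"
  shows "\<exists>c<\<top>. \<forall>k. averaging_kernel k C \<longrightarrow> (\<forall>u\<in>borel_measurable (cube_prob r). \<forall>x\<in>space (cube_prob r).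
    mixint q (averaging_kernel.average k r u) r x \<le> c * mixint q u r x)"
proof -
  from mixint_average_le[of C r q r, OF assms order_refl] obtain c where c: "c < \<top>"
    and le: "\<And>k u x. averaging_kernel k C \<Longrightarrow> u \<in> borel_measurable (cube_prob r) \<Longrightarrow> x \<in> space (cube_prob r) \<Longrightarrow>
      mixint q (averaging_kernel.average k r u) r x
      \<le> c * (\<integral>\<^sup>+ t. averaging_kernel.prod_kernel k r r x t * mixint q u r t \<partial>cube_prob r)"
    by auto
  have "(\<integral>\<^sup>+ t. averaging_kernel.prod_kernel k r r x t * mixint q u r t \<partial>cube_prob r) = mixint q u r x"
    if "averaging_kernel k C" "x \<in> space (cube_prob r)" for k x and u :: "(nat \<Rightarrow> real) \<Rightarrow> ennreal"
  proof -
    have "(\<integral>\<^sup>+ t. averaging_kernel.prod_kernel k r r x t * mixint q u r t \<partial>cube_prob r)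
        = (\<integral>\<^sup>+ t. mixint q u r x \<partial>cube_prob r)"
      using that by (intro nn_integral_cong) (auto simp: averaging_kernel.prod_kernel_top intro!: mixint_top_const)
    then show ?thesis using cube.emeasure_space_1[of r] by simp
  qed
  with c le show ?thesis by (intro exI[of _ c]) auto
qed

section \<open>Dispersion and approximate identities\<close>

lemma ennreal_tendsto_0I:
  fixes f :: "'a \<Rightarrow> ennreal"
  assumes "\<And>e::real. e > 0 \<Longrightarrow> \<forall>\<^sub>F n in F. f n \<le> ennreal e"
  shows "(f \<longlongrightarrow> 0) F"
proof (rule order_tendstoI)
  fix a :: ennreal assume "0 < a"
  then obtain e where e: "0 < e" "ennreal e < a"
    by (metis ennreal_0 ennreal_less_iff ennreal_neg ennreal_rat_dense linorder_not_less order_less_imp_le)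
  show "\<forall>\<^sub>F n in F. f n < a"
    using assms[OF e(1)] by eventually_elim (use e(2) in auto)
qed simp

lemma ennreal_tendsto_0D:
  fixes f :: "'a \<Rightarrow> ennreal"
  shows "(f \<longlongrightarrow> 0) F \<Longrightarrow> 0 < e \<Longrightarrow> \<forall>\<^sub>F n in F. f n \<le> ennreal e"
  by (drule order_tendstoD(2)[of _ _ _ "ennreal e"]) (auto elim: eventually_mono)

lemma nn_integral_cube_component:
  assumes i: "i \<in> {1..r}" and g: "g \<in> borel_measurable borel"
  shows "(\<integral>\<^sup>+ x. g (x i) \<partial>cube_prob r) = (\<integral>\<^sup>+ s. g s \<partial>unif)"
proof -
  have "(\<integral>\<^sup>+ x. g (x i) \<partial>cube_prob r) = (\<integral>\<^sup>+ x. (\<integral>\<^sup>+ s. g ((x(i := s)) i) \<partial>unif) \<partial>cube_prob r)"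
    using measurable_compose[OF measurable_cube_component[OF i] g]
    by (rule nn_integral_cube_average[OF i])
  then show ?thesis using cube.emeasure_space_1[of r] by simp
qed

context averaging_kernel
begin

lemma measurable_prod_kernel_row [measurable]:
  "x \<in> space (cube_prob r) \<Longrightarrow> prod_kernel r j x \<in> borel_measurable (cube_prob r)"
  by (rule measurable_prod_kernel_comp) auto

lemma average_mono:
  "(\<And>t. t \<in> space (cube_prob r) \<Longrightarrow> u t \<le> v t) \<Longrightarrow> average r u x \<le> average r v x"
  unfolding average_def by (intro nn_integral_mono mult_left_mono) auto

lemma average_add:
  assumes "x \<in> space (cube_prob r)" "u \<in> borel_measurable (cube_prob r)" "v \<in> borel_measurable (cube_prob r)"
  shows "average r (\<lambda>t. u t + v t) x = average r u x + average r v x"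
  using assms unfolding average_def by (simp add: distrib_left nn_integral_add)

lemma average_cmult:
  assumes "x \<in> space (cube_prob r)" "u \<in> borel_measurable (cube_prob r)"
  shows "average r (\<lambda>t. c * u t) x = c * average r u x"
  using assms unfolding average_def by (simp add: mult.left_commute[of _ c] nn_integral_cmult)

lemma average_const: "x \<in> space (cube_prob r) \<Longrightarrow> average r (\<lambda>_. c) x = c"
  unfolding average_def by (simp add: nn_integral_multc prod_kernel_row_mass)

text \<open>All rows but the \<open>i\<close>-th integrate to 1. This reduces half spaces to the
  one-dimensional kernel.\<close>

lemma average_component:
  assumes i: "i \<in> {1..r}" and [measurable]: "g \<in> borel_measurable borel"
  shows "average r (\<lambda>t. g (t i)) x = (\<integral>\<^sup>+ s. k (x i) s * g s \<partial>unif)"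
proof -
  have "average r (\<lambda>t. g (t i)) x
      = (\<integral>\<^sup>+ t. (\<Prod>l\<in>{1..r}. k (x l) (t l) * (if l = i then g (t l) else 1)) \<partial>cube_prob r)"
    unfolding average_def prod_kernel_def prod.distrib
    by (intro nn_integral_cong arg_cong2[where f="(*)"] prod.cong) (use i in auto)
  also have "\<dots> = (\<Prod>l\<in>{1..r}. \<integral>\<^sup>+ s. k (x l) s * (if l = i then g s else 1) \<partial>unif)"
    by (rule nn_integral_cube_prod) simp
  also have "\<dots> = (\<Prod>l\<in>{1..r}. if l = i then \<integral>\<^sup>+ s. k (x i) s * g s \<partial>unif else 1)"
    by (intro prod.cong) (auto simp: row_mass)
  finally show ?thesis using i by simp
qed

lemma nn_integral_average_le:
  assumes [measurable]: "u \<in> borel_measurable (cube_prob r)"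
  shows "(\<integral>\<^sup>+ x. average r u x \<partial>cube_prob r) \<le> C ^ r * (\<integral>\<^sup>+ t. u t \<partial>cube_prob r)"
proof -
  have "(\<integral>\<^sup>+ x. average r u x \<partial>cube_prob r)
      = (\<integral>\<^sup>+ t. (\<integral>\<^sup>+ x. prod_kernel r 0 x t * u t \<partial>cube_prob r) \<partial>cube_prob r)"
    unfolding average_def
  proof (rule pair_sigma_finite.Fubini')
    show "pair_sigma_finite (cube_prob r) (cube_prob r)"
      by (simp add: pair_sigma_finite_def cube.sigma_finite_measure_axioms)
    show "(\<lambda>(t, x). prod_kernel r 0 x t * u t) \<in> borel_measurable (cube_prob r \<Otimes>\<^sub>M cube_prob r)"
      by measurable
  qed
  also have "\<dots> \<le> (\<integral>\<^sup>+ t. C ^ r * u t \<partial>cube_prob r)"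
  proof (intro nn_integral_mono)
    fix t assume "t \<in> space (cube_prob r)"
    then have "(\<lambda>x. prod_kernel r 0 x t) \<in> borel_measurable (cube_prob r)"
      by (intro measurable_prod_kernel_comp) auto
    then have "(\<integral>\<^sup>+ x. prod_kernel r 0 x t * u t \<partial>cube_prob r) = (\<integral>\<^sup>+ x. prod_kernel r 0 x t \<partial>cube_prob r) * u t"
      by (rule nn_integral_multc)
    then show "(\<integral>\<^sup>+ x. prod_kernel r 0 x t * u t \<partial>cube_prob r) \<le> C ^ r * u t"
      by (simp add: mult_right_mono prod_kernel_column_mass)
  qed
  also have "\<dots> = C ^ r * (\<integral>\<^sup>+ t. u t \<partial>cube_prob r)"
    by (rule nn_integral_cmult) simp
  finally show ?thesis .
qed

lemma dispersion_mono:
  assumes "\<And>x t. x \<in> space (cube_prob r) \<Longrightarrow> t \<in> space (cube_prob r) \<Longrightarrow> \<bar>h t - h x\<bar> \<le> \<bar>f t - f x\<bar>"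
  shows "dispersion r h \<le> dispersion r f"
  unfolding dispersion_def by (intro nn_integral_mono average_mono ennreal_leI assms)

text \<open>The hypothesis is placed on increments, not on \<open>h\<close> as a sum, so that it
  covers sums, unions of sets and perturbations of a function alike.\<close>

lemma dispersion_triangle:
  assumes [measurable]: "f \<in> borel_measurable (cube_prob r)" "g \<in> borel_measurable (cube_prob r)"
    and le: "\<And>x t. x \<in> space (cube_prob r) \<Longrightarrow> t \<in> space (cube_prob r) \<Longrightarrow>
      \<bar>h t - h x\<bar> \<le> \<bar>f t - f x\<bar> + \<bar>g t - g x\<bar>"
  shows "dispersion r h \<le> dispersion r f + dispersion r g"
proof -
  have "dispersion r h \<le> (\<integral>\<^sup>+ x. average r (\<lambda>t. ennreal \<bar>f t - f x\<bar> + ennreal \<bar>g t - g x\<bar>) x \<partial>cube_prob r)"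
    unfolding dispersion_def using le
    by (intro nn_integral_mono average_mono) (auto simp: ennreal_leI simp flip: ennreal_plus)
  also have "\<dots> = (\<integral>\<^sup>+ x. average r (\<lambda>t. ennreal \<bar>f t - f x\<bar>) x + average r (\<lambda>t. ennreal \<bar>g t - g x\<bar>) x \<partial>cube_prob r)"
    by (intro nn_integral_cong average_add) auto
  also have "\<dots> = dispersion r f + dispersion r g"
    unfolding dispersion_def by (intro nn_integral_add measurable_average_pair) auto
  finally show ?thesis .
qed

lemma dispersion_cmult:
  assumes [measurable]: "f \<in> borel_measurable (cube_prob r)"
  shows "dispersion r (\<lambda>x. c * f x) = ennreal \<bar>c\<bar> * dispersion r f"
proof -
  have "dispersion r (\<lambda>x. c * f x) = (\<integral>\<^sup>+ x. average r (\<lambda>t. ennreal \<bar>c\<bar> * ennreal \<bar>f t - f x\<bar>) x \<partial>cube_prob r)"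
    unfolding dispersion_def by (simp add: abs_mult flip: ennreal_mult right_diff_distrib)
  also have "\<dots> = (\<integral>\<^sup>+ x. ennreal \<bar>c\<bar> * average r (\<lambda>t. ennreal \<bar>f t - f x\<bar>) x \<partial>cube_prob r)"
    by (intro nn_integral_cong average_cmult) auto
  also have "\<dots> = ennreal \<bar>c\<bar> * dispersion r f"
    unfolding dispersion_def by (intro nn_integral_cmult measurable_average_pair) auto
  finally show ?thesis .
qed

text \<open>An increment is at most \<open>\<bar>f t\<bar> + \<bar>f x\<bar>\<close>: the columns
  contribute \<open>C ^ r\<close> to the first term, the rows contribute 1 to the second.\<close>

lemma dispersion_le_L1:
  assumes [measurable]: "f \<in> borel_measurable (cube_prob r)"
  shows "dispersion r f \<le> (C ^ r + 1) * (\<integral>\<^sup>+ x. ennreal \<bar>f x\<bar> \<partial>cube_prob r)"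
proof -
  have "dispersion r f \<le> (\<integral>\<^sup>+ x. average r (\<lambda>t. ennreal \<bar>f t\<bar> + ennreal \<bar>f x\<bar>) x \<partial>cube_prob r)"
    unfolding dispersion_def
    by (intro nn_integral_mono average_mono) (auto simp: ennreal_leI simp flip: ennreal_plus)
  also have "\<dots> = (\<integral>\<^sup>+ x. average r (\<lambda>t. ennreal \<bar>f t\<bar>) x + ennreal \<bar>f x\<bar> \<partial>cube_prob r)"
    by (intro nn_integral_cong) (simp add: average_add average_const)
  also have "\<dots> = (\<integral>\<^sup>+ x. average r (\<lambda>t. ennreal \<bar>f t\<bar>) x \<partial>cube_prob r) + (\<integral>\<^sup>+ x. ennreal \<bar>f x\<bar> \<partial>cube_prob r)"
    by (intro nn_integral_add measurable_average_pair) auto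
  also have "\<dots> \<le> C ^ r * (\<integral>\<^sup>+ x. ennreal \<bar>f x\<bar> \<partial>cube_prob r) + (\<integral>\<^sup>+ x. ennreal \<bar>f x\<bar> \<partial>cube_prob r)"
    by (intro add_right_mono nn_integral_average_le) auto
  finally show ?thesis by (simp add: distrib_right)
qed

text \<open>If \<open>x i\<close> and \<open>t i\<close> lie on different sides of \<open>a\<close>,
  then they are at least \<open>d\<close> apart or \<open>x i\<close> is within \<open>d\<close> of
  \<open>a\<close>. The slab of the second case has length \<open>2 * d\<close>, hence probability
  at most \<open>d\<close>.\<close>

lemma dispersion_halfspace_le:
  assumes i: "i \<in> {1..r}" and d: "0 < d"
  shows "dispersion r (indicator {x \<in> space (cube_prob r). x i \<le> a})
    \<le> (\<integral>\<^sup>+ s. (\<integral>\<^sup>+ t. k s t * indicator {t. d \<le> \<bar>t - s\<bar>} t \<partial>unif) \<partial>unif) + ennreal d"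
proof -
  define H where "H s = (\<integral>\<^sup>+ t. k s t * indicator {t. d \<le> \<bar>t - s\<bar>} t \<partial>unif)" for s
  have [measurable]: "H \<in> borel_measurable borel"
  proof -
    have "(\<lambda>(s, t). k s t * indicator {z. d \<le> \<bar>snd z - fst z\<bar>} (s, t)) \<in> borel_measurable (borel \<Otimes>\<^sub>M unif)"
      by measurable
    from unif.borel_measurable_nn_integral[OF this] show ?thesis
      by (simp add: H_def[abs_def] indicator_def)
  qed
  have "dispersion r (indicator {x \<in> space (cube_prob r). x i \<le> a})
      \<le> (\<integral>\<^sup>+ x. average r (\<lambda>t. indicator {t. d \<le> \<bar>t - x i\<bar>} (t i) + indicator {a-d..a+d} (x i)) x \<partial>cube_prob r)"
    unfolding dispersion_def
    by (intro nn_integral_mono average_mono) (auto simp: indicator_def)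
  also have "\<dots> = (\<integral>\<^sup>+ x. H (x i) + indicator {a-d..a+d} (x i) \<partial>cube_prob r)"
  proof (intro nn_integral_cong)
    fix x assume x: "x \<in> space (cube_prob r)"
    have "(\<lambda>t. indicator {t. d \<le> \<bar>t - x i\<bar>} (t i) :: ennreal) \<in> borel_measurable (cube_prob r)"
      by (rule measurable_compose[OF measurable_cube_component[OF i]]) measurable
    then have "average r (\<lambda>t. indicator {t. d \<le> \<bar>t - x i\<bar>} (t i) + indicator {a-d..a+d} (x i)) x
        = average r (\<lambda>t. indicator {t. d \<le> \<bar>t - x i\<bar>} (t i)) x + indicator {a-d..a+d} (x i)"
      using x by (simp add: average_add average_const)
    also have "average r (\<lambda>t. indicator {t. d \<le> \<bar>t - x i\<bar>} (t i)) x = H (x i)"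
      unfolding H_def by (rule average_component[OF i]) measurable
    finally show "average r (\<lambda>t. indicator {t. d \<le> \<bar>t - x i\<bar>} (t i) + indicator {a-d..a+d} (x i)) x
        = H (x i) + indicator {a-d..a+d} (x i)" .
  qed
  also have "\<dots> = (\<integral>\<^sup>+ s. H s + indicator {a-d..a+d} s \<partial>unif)"
    by (rule nn_integral_cube_component[OF i]) measurable
  also have "\<dots> = (\<integral>\<^sup>+ s. H s \<partial>unif) + emeasure unif {a-d..a+d}"
    by (subst nn_integral_add) auto
  also have "emeasure unif {a-d..a+d} \<le> emeasure lborel {a-d..a+d} / 2"
    by (auto simp: emeasure_unif intro!: divide_right_mono_ennreal emeasure_mono)
  also have "\<dots> = ennreal d"
    using d by (simp add: ennreal_divide_numeral)
  finally show ?thesis by (simp add: H_def)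
qed

end

text \<open>The column bound is common to all \<open>n\<close>, and the mass away from the diagonal
  is small uniformly in \<open>s\<close>. Concentration is asked of the one-dimensional kernels;
  their tensor products inherit it through half spaces.\<close>

locale approximate_identity =
  fixes k :: "nat \<Rightarrow> real \<Rightarrow> real \<Rightarrow> ennreal" and C :: ennreal
  assumes kernel: "\<And>n. averaging_kernel (k n) C"
    and finite_mass: "C < \<top>"
    and concentration: "\<And>d e. 0 < d \<Longrightarrow> 0 < e \<Longrightarrow>
      \<forall>\<^sub>F n in sequentially. \<forall>s\<in>{-1..1}. (\<integral>\<^sup>+ t. k n s t * indicator {t. d \<le> \<bar>t - s\<bar>} t \<partial>unif) \<le> ennreal e"
begin

abbreviation disp :: "nat \<Rightarrow> nat \<Rightarrow> ((nat \<Rightarrow> real) \<Rightarrow> real) \<Rightarrow> ennreal" where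
  "disp n \<equiv> averaging_kernel.dispersion (k n)"

text \<open>Dispersion is at most a multiple of the \<open>L^1\<close> norm that does not depend on
  \<open>n\<close>, so the functions whose dispersion tends to 0 are closed under \<open>L^1\<close>
  limits.\<close>

lemma disp_L1_limit:
  assumes [measurable]: "f \<in> borel_measurable (cube_prob r)" "\<And>m::nat. g m \<in> borel_measurable (cube_prob r)"
    and g: "\<And>m. (\<lambda>n. disp n r (g m)) \<longlonglongrightarrow> 0"
    and lim: "(\<lambda>m. \<integral>\<^sup>+ x. ennreal \<bar>f x - g m x\<bar> \<partial>cube_prob r) \<longlonglongrightarrow> 0"
  shows "(\<lambda>n. disp n r f) \<longlonglongrightarrow> 0"
proof (rule ennreal_tendsto_0I)
  fix e :: real assume e: "0 < e"
  have "C ^ r + 1 < \<top>"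
    using finite_mass by (simp add: power_less_top_ennreal)
  then have "(\<lambda>m. (C ^ r + 1) * (\<integral>\<^sup>+ x. ennreal \<bar>f x - g m x\<bar> \<partial>cube_prob r)) \<longlonglongrightarrow> (C ^ r + 1) * 0"
    using lim by (intro ennreal_tendsto_cmult) auto
  then have "\<forall>\<^sub>F m in sequentially. (C ^ r + 1) * (\<integral>\<^sup>+ x. ennreal \<bar>f x - g m x\<bar> \<partial>cube_prob r) \<le> ennreal (e / 2)"
    using e by (intro ennreal_tendsto_0D) auto
  then obtain m where m: "(C ^ r + 1) * (\<integral>\<^sup>+ x. ennreal \<bar>f x - g m x\<bar> \<partial>cube_prob r) \<le> ennreal (e / 2)"
    by (auto simp: eventually_sequentially)
  have "\<forall>\<^sub>F n in sequentially. disp n r (g m) \<le> ennreal (e / 2)"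
    using e by (intro ennreal_tendsto_0D g) auto
  then show "\<forall>\<^sub>F n in sequentially. disp n r f \<le> ennreal e"
  proof eventually_elim
    case (elim n)
    have "disp n r f \<le> disp n r (g m) + disp n r (\<lambda>x. f x - g m x)"
      by (rule averaging_kernel.dispersion_triangle[OF kernel]) auto
    also have "\<dots> \<le> ennreal (e / 2) + ennreal (e / 2)"
      by (intro add_mono elim order_trans[OF averaging_kernel.dispersion_le_L1[OF kernel] m]) auto
    finally show ?case using e by (simp flip: ennreal_plus)
  qed
qed

lemma disp_Un:
  assumes [measurable]: "A \<in> sets (cube_prob r)" "B \<in> sets (cube_prob r)"
    and "(\<lambda>n. disp n r (indicator A)) \<longlonglongrightarrow> 0" "(\<lambda>n. disp n r (indicator B)) \<longlonglongrightarrow> 0"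
  shows "(\<lambda>n. disp n r (indicator (A \<union> B))) \<longlonglongrightarrow> 0"
proof (rule tendsto_sandwich[OF _ _ tendsto_const])
  show "(\<lambda>n. disp n r (indicator A) + disp n r (indicator B)) \<longlonglongrightarrow> 0"
    using tendsto_add[OF assms(3,4)] by simp
  have "disp n r (indicator (A \<union> B)) \<le> disp n r (indicator A) + disp n r (indicator B)" for n
    by (rule averaging_kernel.dispersion_triangle[OF kernel]) (auto simp: indicator_def)
  then show "\<forall>\<^sub>F n in sequentially. disp n r (indicator (A \<union> B)) \<le> disp n r (indicator A) + disp n r (indicator B)"
    by simp
qed simp

text \<open>Complements have the same increments, finite unions follow from the triangle estimate,
  and a countable union is the \<open>L^1\<close> limit of its finite parts. This takes the place of
  approximation by continuous functions.\<close>

lemma sigma_algebra_disp: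
  "sigma_algebra (space (cube_prob r)) {A \<in> sets (cube_prob r). (\<lambda>n. disp n r (indicator A)) \<longlonglongrightarrow> 0}"
proof -
  let ?\<D> = "{A \<in> sets (cube_prob r). (\<lambda>n. disp n r (indicator A)) \<longlonglongrightarrow> 0}"
  have empty: "{} \<in> ?\<D>"
    using averaging_kernel.dispersion_cmult[OF kernel, of "\<lambda>_. 0" r _ 0] by (simp add: indicator_def[abs_def])
  have Un: "A \<union> B \<in> ?\<D>" if "A \<in> ?\<D>" "B \<in> ?\<D>" for A B
    using that by (auto intro: disp_Un)
  show ?thesis
  proof (rule sigma_algebra_iff2[THEN iffD2], intro conjI ballI allI impI)
    show "?\<D> \<subseteq> Pow (space (cube_prob r))"
      using sets.sets_into_space by auto
    show "{} \<in> ?\<D>" by (rule empty)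
  next
    fix A assume A: "A \<in> ?\<D>"
    have "disp n r (indicator (space (cube_prob r) - A)) = disp n r (indicator A)" for n
      by (intro antisym averaging_kernel.dispersion_mono[OF kernel]) (auto simp: indicator_def)
    with A show "space (cube_prob r) - A \<in> ?\<D>" by auto
  next
    fix A :: "nat \<Rightarrow> _" assume A: "range A \<subseteq> ?\<D>"
    then have [measurable]: "A i \<in> sets (cube_prob r)" for i by auto
    have fin: "(\<Union>i<m. A i) \<in> ?\<D>" for m
    proof (induction m)
      case (Suc m)
      have "(\<Union>i<Suc m. A i) = (\<Union>i<m. A i) \<union> A m" by (auto simp: less_Suc_eq)
      with Un[OF Suc, of "A m"] A show ?case by auto
    qed (use empty in simp)
    have "(\<lambda>n. disp n r (indicator (\<Union>i. A i))) \<longlonglongrightarrow> 0"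
    proof (rule disp_L1_limit)
      show "(\<lambda>n. disp n r (indicator (\<Union>i<m. A i))) \<longlonglongrightarrow> 0" for m
        using fin by blast
      have "(\<lambda>m. \<integral>\<^sup>+ x. norm (indicator (\<Union>i. A i) x - indicator (\<Union>i<m. A i) x :: real) \<partial>cube_prob r) \<longlonglongrightarrow> 0"
        by (rule nn_integral_dominated_convergence_norm[where w="\<lambda>_. 1"])
          (auto simp: cube.emeasure_space_1 intro!: AE_I2 LIMSEQ_indicator_UN)
      then show "(\<lambda>m. \<integral>\<^sup>+ x. ennreal \<bar>indicator (\<Union>i. A i) x - indicator (\<Union>i<m. A i) x\<bar> \<partial>cube_prob r) \<longlonglongrightarrow> 0"
        by simp
    qed auto
    then show "(\<Union>i. A i) \<in> ?\<D>" by auto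
  qed
qed

lemma disp_halfspace:
  assumes i: "i \<in> {1..r}"
  shows "(\<lambda>n. disp n r (indicator {x \<in> space (cube_prob r). x i \<le> a})) \<longlonglongrightarrow> 0"
proof (rule ennreal_tendsto_0I)
  fix e :: real assume e: "0 < e"
  \<comment> \<open>\<open>e / 2\<close> has two roles: it is the distance, and thereby the
    probability allowed for the slab around \<open>a\<close>, and it bounds the mass away from the
    diagonal.\<close>
  then have "\<forall>\<^sub>F n in sequentially. \<forall>s\<in>{-1..1}.
      (\<integral>\<^sup>+ t. k n s t * indicator {t. e / 2 \<le> \<bar>t - s\<bar>} t \<partial>unif) \<le> ennreal (e / 2)"
    by (intro concentration) auto
  then show "\<forall>\<^sub>F n in sequentially. disp n r (indicator {x \<in> space (cube_prob r). x i \<le> a}) \<le> ennreal e"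
  proof eventually_elim
    case (elim n)
    have "AE s in unif. s \<in> {-1..1}"
      by (simp add: AE_unif)
    then have "(\<integral>\<^sup>+ s. (\<integral>\<^sup>+ t. k n s t * indicator {t. e / 2 \<le> \<bar>t - s\<bar>} t \<partial>unif) \<partial>unif) \<le> (\<integral>\<^sup>+ s. ennreal (e / 2) \<partial>unif)"
      by (intro nn_integral_mono_AE) (use elim in auto)
    also have "\<dots> = ennreal (e / 2)"
      using unif.emeasure_space_1 by simp
    finally have "(\<integral>\<^sup>+ s. (\<integral>\<^sup>+ t. k n s t * indicator {t. e / 2 \<le> \<bar>t - s\<bar>} t \<partial>unif) \<partial>unif) + ennreal (e / 2)
        \<le> ennreal (e / 2) + ennreal (e / 2)"
      by (rule add_right_mono)
    also have "\<dots> = ennreal e" using e by (simp flip: ennreal_plus)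
    finally show ?case
      using averaging_kernel.dispersion_halfspace_le[OF kernel i, of "e / 2" n a] e
      by (meson half_gt_zero order_trans)
  qed
qed

text \<open>Let the good sets be the measurable sets of a space \<open>N\<close>. That they contain
  the half spaces says that every coordinate is measurable on \<open>N\<close>; hence preimages of
  Borel sets under coordinates are good, and these generate the product.\<close>

lemma disp_indicator:
  assumes A: "A \<in> sets (cube_prob r)"
  shows "(\<lambda>n. disp n r (indicator A)) \<longlonglongrightarrow> 0"
proof -
  let ?\<D> = "{A \<in> sets (cube_prob r). (\<lambda>n. disp n r (indicator A)) \<longlonglongrightarrow> 0}"
  interpret D: sigma_algebra "space (cube_prob r)" ?\<D>
    by (rule sigma_algebra_disp)
  define N where "N = sigma (space (cube_prob r)) ?\<D>"
  have N: "sets N = ?\<D>" "space N = space (cube_prob r)"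
    unfolding N_def using D.space_closed by (simp_all add: D.sets_measure_of_eq)
  have coord: "(\<lambda>x. x i) \<in> borel_measurable N" if i: "i \<in> {1..r}" for i
  proof (unfold borel_measurable_iff_le, intro allI)
    fix a
    have "{x \<in> space (cube_prob r). x i \<le> a} \<in> sets (cube_prob r)"
      using measurable_cube_component[OF i] by measurable
    with disp_halfspace[OF i, of a] show "{x \<in> space N. x i \<le> a} \<in> sets N"
      by (simp add: N)
  qed
  have "sets (cube_prob r) = sigma_sets (\<Pi>\<^sub>E i\<in>{1..r}. UNIV)
      {{f \<in> \<Pi>\<^sub>E i\<in>{1..r}. UNIV. f i \<in> B} |i B. i \<in> {1..r} \<and> B \<in> sets borel}"
    unfolding cube_prob_def sets_PiM_single by simp
  also have "\<dots> \<subseteq> ?\<D>"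
    unfolding space_cube_prob[symmetric]
  proof (intro D.sigma_sets_subset subsetI)
    fix X assume "X \<in> {{f \<in> space (cube_prob r). f i \<in> B} |i B. i \<in> {1..r} \<and> B \<in> sets borel}"
    then obtain i B where iB: "i \<in> {1..r}" "B \<in> sets borel" and X: "X = {f \<in> space (cube_prob r). f i \<in> B}"
      by blast
    have "X = (\<lambda>x. x i) -` B \<inter> space N"
      by (auto simp: X N)
    with measurable_sets[OF coord iB(2)] iB(1) show "X \<in> ?\<D>"
      unfolding N(1) by simp
  qed
  finally show ?thesis using A by auto
qed

lemma disp_tendsto_0:
  assumes "integrable (cube_prob r) f"
  shows "(\<lambda>n. disp n r f) \<longlonglongrightarrow> 0"
  using assms
proof (induction rule: integrable_induct)
  case (base A c)
  have "disp n r (\<lambda>x. indicator A x *\<^sub>R c) = ennreal \<bar>c\<bar> * disp n r (indicator A)" for n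
    using averaging_kernel.dispersion_cmult[OF kernel, of "indicator A" r n c] base by (simp add: mult.commute)
  moreover have "(\<lambda>n. ennreal \<bar>c\<bar> * disp n r (indicator A)) \<longlonglongrightarrow> ennreal \<bar>c\<bar> * 0"
    by (intro ennreal_tendsto_cmult disp_indicator base) auto
  ultimately show ?case by simp
next
  case (add f g)
  have [measurable]: "f \<in> borel_measurable (cube_prob r)" "g \<in> borel_measurable (cube_prob r)"
    using add by auto
  show ?case
  proof (rule tendsto_sandwich[OF _ _ tendsto_const])
    show "(\<lambda>n. disp n r f + disp n r g) \<longlonglongrightarrow> 0"
      using tendsto_add[OF add(3,4)] by simp
    have "disp n r (\<lambda>x. f x + g x) \<le> disp n r f + disp n r g" for n
      by (rule averaging_kernel.dispersion_triangle[OF kernel]) auto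
    then show "\<forall>\<^sub>F n in sequentially. disp n r (\<lambda>x. f x + g x) \<le> disp n r f + disp n r g"
      by simp
  qed simp
next
  case (lim f s)
  have [measurable]: "f \<in> borel_measurable (cube_prob r)" "\<And>m. s m \<in> borel_measurable (cube_prob r)"
    using lim by auto
  have "(\<lambda>m. \<integral>\<^sup>+ x. norm (f x - s m x) \<partial>cube_prob r) \<longlonglongrightarrow> 0"
  \<comment> \<open>The approximants supplied by the induction obey
    \<open>norm (s m x) \<le> 2 * norm (f x)\<close>.\<close>
  proof (rule nn_integral_dominated_convergence_norm[where w="\<lambda>x. 2 * norm (f x)"])
    have "integrable (cube_prob r) (\<lambda>x. 2 * norm (f x))"
      using lim by auto
    then show "(\<integral>\<^sup>+ x. ennreal (2 * norm (f x)) \<partial>cube_prob r) < \<infinity>"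
      by (drule_tac integrable_iff_bounded[THEN iffD1]) (simp add: abs_mult)
  qed (use lim in auto)
  then show ?case
    using lim by (intro disp_L1_limit[of f r s]) auto
qed

end

section \<open>The Kantorovich kernel\<close>

lemma cube_in_sets [measurable]: "cube r \<in> sets (Pi\<^sub>M {1..r} (\<lambda>_. lborel))"
  unfolding cube_def by (intro sets_PiM_I_finite) auto

text \<open>Both sides agree on boxes, which determines the measure. This links the probability
  space of the estimates to the Lebesgue product measure over which the operator integrates.\<close>

lemma cube_prob_eq_density:
  "cube_prob r = density (Pi\<^sub>M {1..r} (\<lambda>_. lborel)) (\<lambda>x. inverse 2 ^ r * indicator (cube r) x)"
  unfolding cube_prob_def
proof (rule unifs.PiM_eqI[symmetric])
  interpret lb: product_sigma_finite "\<lambda>_::nat. lborel::real measure"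
    by standard
  fix A :: "nat \<Rightarrow> real set" assume "\<And>i. i \<in> {1..r} \<Longrightarrow> A i \<in> sets unif"
  then have A: "\<And>i. i \<in> {1..r} \<Longrightarrow> A i \<in> sets borel" by simp
  then have [measurable]: "Pi\<^sub>E {1..r} A \<in> sets (Pi\<^sub>M {1..r} (\<lambda>_. lborel))"
    by (intro sets_PiM_I_finite) auto
  have "emeasure (density (Pi\<^sub>M {1..r} (\<lambda>_. lborel)) (\<lambda>x. inverse 2 ^ r * indicator (cube r) x)) (Pi\<^sub>E {1..r} A)
      = (\<integral>\<^sup>+ x. inverse 2 ^ r * indicator (cube r \<inter> Pi\<^sub>E {1..r} A) x \<partial>Pi\<^sub>M {1..r} (\<lambda>_. lborel))"
    by (subst emeasure_density) (auto simp: indicator_inter_arith mult.assoc simp del: One_nat_def)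
  also have "\<dots> = inverse 2 ^ r * emeasure (Pi\<^sub>M {1..r} (\<lambda>_. lborel)) (cube r \<inter> Pi\<^sub>E {1..r} A)"
    by (rule nn_integral_cmult_indicator) measurable
  also have "cube r \<inter> Pi\<^sub>E {1..r} A = Pi\<^sub>E {1..r} (\<lambda>i. {-1..1} \<inter> A i)"
    by (simp add: cube_def PiE_Int)
  also have "emeasure (Pi\<^sub>M {1..r} (\<lambda>_. lborel)) (Pi\<^sub>E {1..r} (\<lambda>i. {-1..1} \<inter> A i))
      = (\<Prod>i\<in>{1..r}. emeasure lborel ({-1..1} \<inter> A i))"
    using A by (intro lb.emeasure_PiM) auto
  also have "inverse 2 ^ r * \<dots> = (\<Prod>i\<in>{1..r}. inverse 2 * emeasure lborel ({-1..1} \<inter> A i))"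
    by (simp add: prod.distrib)
  also have "\<dots> = (\<Prod>i\<in>{1..r}. emeasure unif (A i))"
    using A by (intro prod.cong) (auto simp: emeasure_unif divide_ennreal_def mult.commute)
  finally show "emeasure (density (Pi\<^sub>M {1..r} (\<lambda>_. lborel)) (\<lambda>x. inverse 2 ^ r * indicator (cube r) x)) (Pi\<^sub>E {1..r} A)
      = (\<Prod>i\<in>{1..r}. emeasure unif (A i))" .
qed (auto cong: sets_PiM_cong)

lemma sets_cube_prob: "sets (cube_prob r) = sets (Pi\<^sub>M {1..r} (\<lambda>_. lborel))"
  by (simp add: cube_prob_eq_density)

lemma borel_measurable_cube_prob:
  "borel_measurable (cube_prob r) = borel_measurable (Pi\<^sub>M {1..r} (\<lambda>_. lborel))"
  by (rule measurable_cong_sets[OF sets_cube_prob refl])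

lemma nn_integral_cube_prob:
  assumes g: "g \<in> borel_measurable (cube_prob r)"
  shows "2 ^ r * (\<integral>\<^sup>+ x. g x \<partial>cube_prob r) = (\<integral>\<^sup>+ x\<in>cube r. g x \<partial>Pi\<^sub>M {1..r} (\<lambda>_. lborel))"
proof -
  have [measurable]: "g \<in> borel_measurable (Pi\<^sub>M {1..r} (\<lambda>_. lborel))"
    using g by (simp add: borel_measurable_cube_prob)
  have "(\<integral>\<^sup>+ x. g x \<partial>cube_prob r) = (\<integral>\<^sup>+ x. inverse 2 ^ r * (g x * indicator (cube r) x) \<partial>Pi\<^sub>M {1..r} (\<lambda>_. lborel))"
    unfolding cube_prob_eq_density by (subst nn_integral_density) (auto simp: mult_ac simp del: One_nat_def)
  also have "\<dots> = inverse 2 ^ r * (\<integral>\<^sup>+ x\<in>cube r. g x \<partial>Pi\<^sub>M {1..r} (\<lambda>_. lborel))"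
    by (rule nn_integral_cmult) measurable
  finally have "2 ^ r * (\<integral>\<^sup>+ x. g x \<partial>cube_prob r)
      = (2 * inverse 2) ^ r * (\<integral>\<^sup>+ x\<in>cube r. g x \<partial>Pi\<^sub>M {1..r} (\<lambda>_. lborel))"
    by (simp only: power_mult_distrib mult.assoc)
  also have "2 * inverse 2 = (1::ennreal)"
    using ennreal_divide_self[of 2] unfolding divide_ennreal_def by auto
  finally show ?thesis by simp
qed

lemma AE_cube_prob: "(AE x in cube_prob r. P x) \<longleftrightarrow> (AE x in Pi\<^sub>M {1..r} (\<lambda>_. lborel). x \<in> cube r \<longrightarrow> P x)"
proof -
  have m: "(\<lambda>x. inverse 2 ^ r * indicator (cube r) x :: ennreal) \<in> borel_measurable (Pi\<^sub>M {1..r} (\<lambda>_. lborel))"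
    by measurable
  have "inverse (2 :: ennreal) \<noteq> 0" by simp
  then have "(0 :: ennreal) < inverse 2 ^ r"
    unfolding zero_less_iff_neq_zero by (rule power_not_zero)
  then have "0 < inverse 2 ^ r * (indicator (cube r) x :: ennreal) \<longleftrightarrow> x \<in> cube r" for x
    by (cases "x \<in> cube r") simp_all
  then show ?thesis
    by (simp only: cube_prob_eq_density AE_density[OF m])
qed

lemma nn_integral_sum_indicator:
  assumes A: "\<And>k. k \<in> K \<Longrightarrow> A k \<in> sets M"
  shows "(\<integral>\<^sup>+ t. (\<Sum>k\<in>K. c k * indicator (A k) t) \<partial>M) = (\<Sum>k\<in>K. c k * emeasure M (A k))"
proof -
  have "(\<integral>\<^sup>+ t. (\<Sum>k\<in>K. c k * indicator (A k) t) \<partial>M) = (\<Sum>k\<in>K. \<integral>\<^sup>+ t. c k * indicator (A k) t \<partial>M)"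
    by (rule nn_integral_sum) (use A in auto)
  also have "\<dots> = (\<Sum>k\<in>K. c k * emeasure M (A k))"
    using A by (intro sum.cong refl nn_integral_cmult_indicator)
  finally show ?thesis .
qed

text \<open>The left side is the modulus of the mean of \<open>f - c\<close>. If the right side is
  infinite there is nothing to show; otherwise \<open>f - c\<close> is integrable on
  \<open>A\<close>, and so is \<open>f\<close> because \<open>A\<close> has finite measure. Thus the
  estimate holds for every measurable \<open>f\<close>.\<close>

lemma mean_deviation_le:
  fixes f :: "'a \<Rightarrow> real"
  assumes [measurable]: "f \<in> borel_measurable M" "A \<in> sets M" and A: "emeasure M A = ennreal a" "0 < a"
  shows "ennreal \<bar>c - 1 / a * (LINT t:A|M. f t)\<bar> \<le> ennreal (1 / a) * (\<integral>\<^sup>+ t\<in>A. ennreal \<bar>f t - c\<bar> \<partial>M)"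
proof (cases "(\<integral>\<^sup>+ t\<in>A. ennreal \<bar>f t - c\<bar> \<partial>M) = \<top>")
  case True
  then show ?thesis using A by (simp add: ennreal_mult_top)
next
  case False
  have eq: "(\<integral>\<^sup>+ t\<in>A. ennreal \<bar>f t - c\<bar> \<partial>M) = (\<integral>\<^sup>+ t. ennreal (norm (indicator A t *\<^sub>R (f t - c))) \<partial>M)"
    by (intro nn_integral_cong) (auto simp: indicator_def)
  have int: "set_integrable M A (\<lambda>t. f t - c)"
    unfolding set_integrable_def integrable_iff_bounded using False eq by (auto simp: less_top)
  have const: "set_integrable M A (\<lambda>_. c)"
    unfolding set_integrable_def using A by (auto intro!: integrable_mult_left integrable_real_indicator)
  have "(LINT t:A|M. f t) = (LINT t:A|M. f t - c) + (LINT t:A|M. c)"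
    by (subst set_integral_add(2)[symmetric]) (use int const in auto)
  also have "(LINT t:A|M. c) = a * c"
    using A by (simp add: set_lebesgue_integral_def measure_def)
  finally have "c - 1 / a * (LINT t:A|M. f t) = - (1 / a * (LINT t:A|M. f t - c))"
    using A by (simp add: field_simps)
  then have "ennreal \<bar>c - 1 / a * (LINT t:A|M. f t)\<bar> = ennreal (1 / a) * ennreal (norm (LINT t:A|M. f t - c))"
    using A by (simp add: abs_mult flip: ennreal_mult)
  also have "ennreal (norm (LINT t:A|M. f t - c)) \<le> (\<integral>\<^sup>+ t\<in>A. ennreal \<bar>f t - c\<bar> \<partial>M)"
    unfolding eq set_lebesgue_integral_def
    using int by (intro integral_norm_bound_ennreal) (simp add: set_integrable_def)
  finally show ?thesis by (simp add: mult_left_mono)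
qed

text \<open>In \<open>partition\<close> the period \<open>{0..1}\<close> stands for the whole line,
  since shifting the argument by an integer reindexes the series. The bounds \<open>lower\<close>
  and \<open>pos\<close> keep the denominators away from 0.\<close>

locale density_function =
  fixes \<psi> :: "real \<Rightarrow> real"
  assumes nonneg: "\<And>x. 0 \<le> \<psi> x"
    and integral_1: "has_bochner_integral lborel \<psi> 1"
    and partition: "uniform_limit {0..1} (\<lambda>F x. \<Sum>k\<in>F. \<psi> (x - real_of_int k)) (\<lambda>_. 1) (finite_subsets_at_top UNIV)"
    and lower: "\<And>n x. n \<ge> 1 \<Longrightarrow> x \<in> {-1..1} \<Longrightarrow>
      (\<Sum>k\<in>{- int n..int n - 1}. \<psi> (real n * x - real_of_int k)) \<ge> \<psi> 2"
    and pos: "\<psi> 2 > 0"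
begin

lemma measurable_density [measurable]: "\<psi> \<in> borel_measurable borel"
  using integral_1 by (auto dest: borel_measurable_has_bochner_integral)

definition denominator :: "nat \<Rightarrow> real \<Rightarrow> real" where
  "denominator n x = (\<Sum>k\<in>{- int n..int n - 1}. \<psi> (real n * x - real_of_int k))"

definition weight :: "nat \<Rightarrow> real \<Rightarrow> int \<Rightarrow> real" where
  "weight n x k = \<psi> (real n * x - real_of_int k) / denominator n x"

abbreviation interval :: "nat \<Rightarrow> int \<Rightarrow> real set" where
  "interval n k \<equiv> {real_of_int k / real n..(real_of_int k + 1) / real n}"

text \<open>The value \<open>1\<close> off \<open>{-1..1}\<close>, where the denominator may vanish, gives every row mass \<open>1\<close>.\<close>

definition kantorovich_kernel :: "nat \<Rightarrow> real \<Rightarrow> real \<Rightarrow> ennreal" where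
  "kantorovich_kernel n x t = (if x \<in> {-1..1}
     then \<Sum>k\<in>{- int n..int n - 1}. ennreal (2 * real n * weight n x k) * indicator (interval n k) t
     else 1)"

section \<open>Weights and masses of the one-dimensional kernel\<close>

lemma measurable_weight [measurable]: "(\<lambda>x. weight n x k) \<in> borel_measurable borel"
  unfolding weight_def denominator_def by measurable

lemma denominator_pos: "n \<ge> 1 \<Longrightarrow> x \<in> {-1..1} \<Longrightarrow> 0 < denominator n x"
  using lower[of n x] pos by (simp add: denominator_def)

lemma weight_nonneg: "0 \<le> weight n x k"
  unfolding weight_def denominator_def by (intro divide_nonneg_nonneg sum_nonneg nonneg)

lemma weight_le: "n \<ge> 1 \<Longrightarrow> x \<in> {-1..1} \<Longrightarrow> weight n x k \<le> \<psi> (real n * x - real_of_int k) / \<psi> 2"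
  unfolding weight_def using lower[of n x] pos
  by (intro divide_left_mono) (auto simp: denominator_def nonneg)

lemma sum_weight:
  assumes "n \<ge> 1" "x \<in> {-1..1}"
  shows "(\<Sum>k\<in>{- int n..int n - 1}. weight n x k) = 1"
  using denominator_pos[OF assms]
  by (simp add: weight_def flip: sum_divide_distrib denominator_def)

text \<open>An interval of length \<open>1 / n\<close> has normalised measure
  \<open>1 / (2 * n)\<close>; this is why the kernel carries the factor
  \<open>2 * real n\<close>.\<close>

lemma emeasure_unif_interval:
  assumes "n \<ge> 1" "k \<in> {- int n..int n - 1}"
  shows "emeasure unif (interval n k) = ennreal (1 / (2 * real n))"
proof -
  have "- real n \<le> real_of_int k" "real_of_int k + 1 \<le> real n"
    using assms(2) by auto
  then have "interval n k \<subseteq> {-1..1}"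
    using assms(1) by (auto simp: field_simps intro: order_trans)
  then have "{-1..1} \<inter> interval n k = interval n k" by blast
  then show ?thesis
    using assms(1) by (simp add: emeasure_unif emeasure_lborel_Icc_eq ennreal_divide_numeral divide_right_mono diff_divide_distrib[symmetric])
qed

lemma kernel_row_mass:
  assumes "n \<ge> 1"
  shows "(\<integral>\<^sup>+ t. kantorovich_kernel n x t \<partial>unif) = 1"
proof (cases "x \<in> {-1..1}")
  case True
  have "(\<integral>\<^sup>+ t. kantorovich_kernel n x t \<partial>unif)
      = (\<Sum>k\<in>{- int n..int n - 1}. ennreal (2 * real n * weight n x k) * emeasure unif (interval n k))"
    unfolding kantorovich_kernel_def if_P[OF True]
    by (rule nn_integral_sum_indicator) simp
  also have "\<dots> = (\<Sum>k\<in>{- int n..int n - 1}. ennreal (weight n x k))"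
    using assms by (intro sum.cong) (auto simp: emeasure_unif_interval weight_nonneg simp flip: ennreal_mult)
  also have "\<dots> = 1"
    using assms True by (simp add: sum_ennreal weight_nonneg sum_weight)
  finally show ?thesis .
next
  case False
  then have "kantorovich_kernel n x = (\<lambda>_. 1)"
    by (auto simp: kantorovich_kernel_def)
  then show ?thesis
    using unif.emeasure_space_1 by simp
qed

text \<open>The substitution \<open>y = n * x - k\<close> turns the total mass 1 of the density into
  \<open>1 / n\<close>, and the lower bound of the denominator contributes
  \<open>1 / \<psi> 2\<close>.\<close>

lemma nn_integral_weight_le:
  assumes n: "n \<ge> 1"
  shows "(\<integral>\<^sup>+ x\<in>{-1..1}. ennreal (weight n x k) \<partial>lborel) \<le> ennreal (1 / (real n * \<psi> 2))"
proof -
  have "ennreal 1 = (\<integral>\<^sup>+ y. ennreal (\<psi> y) \<partial>lborel)"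
    using integral_1 by (simp add: nn_integral_eq_integral has_bochner_integral_iff nonneg)
  also have "\<dots> = ennreal (real n) * (\<integral>\<^sup>+ x. ennreal (\<psi> (- real_of_int k + real n * x)) \<partial>lborel)"
    using n by (subst nn_integral_real_affine[where c="real n" and t="- real_of_int k"]) auto
  finally have 1: "ennreal (real n) * (\<integral>\<^sup>+ x. ennreal (\<psi> (real n * x - real_of_int k)) \<partial>lborel) = 1"
    by (simp add: add.commute)
  have "(\<integral>\<^sup>+ x\<in>{-1..1}. ennreal (weight n x k) \<partial>lborel)
      \<le> (\<integral>\<^sup>+ x. ennreal (1 / \<psi> 2) * ennreal (\<psi> (real n * x - real_of_int k)) \<partial>lborel)"
    using n pos weight_le[OF n, of _ k]
    by (intro nn_integral_mono) (auto simp: indicator_def nonneg ennreal_leI simp flip: ennreal_mult)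
  also have "\<dots> = ennreal (1 / \<psi> 2) * (\<integral>\<^sup>+ x. ennreal (\<psi> (real n * x - real_of_int k)) \<partial>lborel)"
    by (rule nn_integral_cmult) measurable
  also have "\<dots> = ennreal (1 / (real n * \<psi> 2)) *
      (ennreal (real n) * (\<integral>\<^sup>+ x. ennreal (\<psi> (real n * x - real_of_int k)) \<partial>lborel))"
    using n pos by (simp add: mult.assoc[symmetric] flip: ennreal_mult)
  finally show ?thesis by (simp add: 1)
qed

text \<open>Each interval that contains \<open>t\<close> contributes at most
  \<open>1 / \<psi> 2\<close>. The intervals are closed, so \<open>t\<close> may be a common
  endpoint of two of them: this accounts for the numerator 2.\<close>

lemma kernel_column_mass:
  assumes n: "n \<ge> 1"
  shows "(\<integral>\<^sup>+ x. kantorovich_kernel n x t \<partial>unif) \<le> ennreal (2 / \<psi> 2)"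
proof -
  let ?K = "{- int n..int n - 1}"
  have "(\<integral>\<^sup>+ x. kantorovich_kernel n x t \<partial>unif)
      = (\<integral>\<^sup>+ x. (\<Sum>k\<in>?K. ennreal (2 * real n * weight n x k) * indicator (interval n k) t) \<partial>unif)"
    by (intro nn_integral_cong_AE) (auto simp: AE_unif kantorovich_kernel_def)
  also have "\<dots> = (\<Sum>k\<in>?K. (\<integral>\<^sup>+ x. 2 * ennreal (weight n x k) \<partial>unif) * (ennreal (real n) * indicator (interval n k) t))"
  proof -
    have "(\<integral>\<^sup>+ x. ennreal (2 * real n * weight n x k) * indicator (interval n k) t \<partial>unif)
        = (\<integral>\<^sup>+ x. 2 * ennreal (weight n x k) \<partial>unif) * (ennreal (real n) * indicator (interval n k) t)" for k
    proof -
      have "ennreal (2 * real n * weight n x k) * indicator (interval n k) t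
          = 2 * ennreal (weight n x k) * (ennreal (real n) * indicator (interval n k) t)" for x
        by (simp add: ennreal_mult weight_nonneg mult_ac)
      then show ?thesis by (simp add: nn_integral_multc)
    qed
    then show ?thesis by (subst nn_integral_sum) simp_all
  qed
  also have "\<dots> \<le> (\<Sum>k\<in>?K. ennreal (1 / (real n * \<psi> 2)) * (ennreal (real n) * indicator (interval n k) t))"
  proof (intro sum_mono mult_right_mono)
    fix k
    have "(\<integral>\<^sup>+ x. 2 * ennreal (weight n x k) \<partial>unif) = (\<integral>\<^sup>+ x\<in>{-1..1}. ennreal (weight n x k) \<partial>lborel)"
      by (subst nn_integral_unif[symmetric]) (auto simp: nn_integral_cmult)
    then show "(\<integral>\<^sup>+ x. 2 * ennreal (weight n x k) \<partial>unif) \<le> ennreal (1 / (real n * \<psi> 2))"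
      using nn_integral_weight_le[OF n] by simp
  qed simp
  also have "\<dots> = (\<Sum>k\<in>?K. ennreal (1 / \<psi> 2) * indicator (interval n k) t)"
    using n pos by (intro sum.cong) (auto simp: mult.assoc[symmetric] simp flip: ennreal_mult)
  also have "\<dots> \<le> (\<Sum>k\<in>{\<lfloor>real n * t\<rfloor> - 1, \<lfloor>real n * t\<rfloor>}. ennreal (1 / \<psi> 2))"
  proof -
    have "k = \<lfloor>real n * t\<rfloor> - 1 \<or> k = \<lfloor>real n * t\<rfloor>" if "t \<in> interval n k" for k
    proof -
      have "real_of_int k \<le> real n * t" "real n * t \<le> real_of_int k + 1"
        using that n by (auto simp: field_simps)
      then show ?thesis by linarith
    qed
    then have "(\<Sum>k\<in>?K. ennreal (1 / \<psi> 2) * indicator (interval n k) t)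
        = (\<Sum>k\<in>?K \<inter> {\<lfloor>real n * t\<rfloor> - 1, \<lfloor>real n * t\<rfloor>}. ennreal (1 / \<psi> 2) * indicator (interval n k) t)"
      by (intro sum.mono_neutral_right) (auto simp: indicator_def)
    also have "\<dots> \<le> (\<Sum>k\<in>?K \<inter> {\<lfloor>real n * t\<rfloor> - 1, \<lfloor>real n * t\<rfloor>}. ennreal (1 / \<psi> 2))"
      by (intro sum_mono) (auto simp: indicator_def)
    also have "\<dots> \<le> (\<Sum>k\<in>{\<lfloor>real n * t\<rfloor> - 1, \<lfloor>real n * t\<rfloor>}. ennreal (1 / \<psi> 2))"
      by (intro sum_mono2) auto
    finally show ?thesis .
  qed
  also have "\<dots> = ennreal (2 / \<psi> 2)"
    using ennreal_mult'[of 2 "1 / \<psi> 2"] by simp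
  finally show ?thesis .
qed

lemma measurable_kantorovich_kernel:
  "case_prod (kantorovich_kernel n) \<in> borel_measurable (borel \<Otimes>\<^sub>M borel)"
proof -
  have [measurable]: "{z \<in> space (borel \<Otimes>\<^sub>M borel). snd z \<in> interval n k} \<in> sets (borel \<Otimes>\<^sub>M (borel :: real measure))" for k
    by measurable
  show ?thesis
    unfolding kantorovich_kernel_def split_def by measurable
qed

lemma averaging_kernel_kantorovich:
  "n \<ge> 1 \<Longrightarrow> averaging_kernel (kantorovich_kernel n) (ennreal (2 / \<psi> 2))"
  by standard (simp_all add: measurable_kantorovich_kernel kernel_row_mass kernel_column_mass)

text \<open>A Cauchy argument, uniform in \<open>y\<close>: the sums over \<open>F\<close> and over
  \<open>F\<close> enlarged by far indices are both within \<open>e / 2\<close> of 1, so the far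
  indices contribute at most \<open>e\<close>. Translation by the floor of \<open>y\<close> moves
  the argument into the period where convergence is uniform.\<close>

lemma density_tail_small:
  assumes e: "0 < e"
  obtains R where "\<And>y S. finite S \<Longrightarrow> (\<And>k. k \<in> S \<Longrightarrow> R \<le> \<bar>y - real_of_int k\<bar>) \<Longrightarrow>
    (\<Sum>k\<in>S. \<psi> (y - real_of_int k)) \<le> e"
proof -
  have "\<forall>\<^sub>F F in finite_subsets_at_top UNIV. \<forall>x\<in>{0..1}. dist (\<Sum>k\<in>F. \<psi> (x - real_of_int k)) 1 < e / 2"
    by (rule uniform_limitD[OF partition half_gt_zero[OF e]])
  then obtain F where F: "finite F"
    and close: "\<forall>F'. finite F' \<and> F \<subseteq> F' \<and> F' \<subseteq> UNIV \<longrightarrow>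
      (\<forall>x\<in>{0..1}. dist (\<Sum>k\<in>F'. \<psi> (x - real_of_int k)) 1 < e / 2)"
    unfolding eventually_finite_subsets_at_top by (elim exE conjE)
  define B where "B = Max (abs ` F)"
  have B: "\<bar>k\<bar> \<le> B" if "k \<in> F" for k
    using F that by (auto simp: B_def)
  show thesis
  \<comment> \<open>\<open>B\<close> bounds the indices in \<open>F\<close>. The extra 2 absorbs the
    distance, less than 1, from \<open>y\<close> to its floor, so that the shifted far indices miss
    \<open>F\<close>.\<close>
  proof (rule that[of "real_of_int B + 2"])
    fix y and S :: "int set"
    assume S: "finite S" and far: "\<And>k. k \<in> S \<Longrightarrow> real_of_int B + 2 \<le> \<bar>y - real_of_int k\<bar>"
    define y' where "y' = y - real_of_int \<lfloor>y\<rfloor>"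
    have y': "y' \<in> {0..1}" by (simp add: y'_def) linarith
    define S' where "S' = (\<lambda>k. k - \<lfloor>y\<rfloor>) ` S"
    have "F \<inter> S' = {}"
    proof (rule equals0I)
      fix k' assume "k' \<in> F \<inter> S'"
      then obtain k where k: "k \<in> S" "k' = k - \<lfloor>y\<rfloor>" and "\<bar>k'\<bar> \<le> B"
        using B by (auto simp: S'_def)
      then show False using far[OF k(1)] by linarith
    qed
    moreover have "finite S'" using S by (simp add: S'_def)
    ultimately have split: "(\<Sum>k\<in>F \<union> S'. \<psi> (y' - real_of_int k))
        = (\<Sum>k\<in>F. \<psi> (y' - real_of_int k)) + (\<Sum>k\<in>S'. \<psi> (y' - real_of_int k))"
      using F by (intro sum.union_disjoint) auto
    have "(\<Sum>k\<in>S'. \<psi> (y' - real_of_int k)) = (\<Sum>k\<in>S. \<psi> (y - real_of_int k))"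
      unfolding S'_def by (subst sum.reindex) (auto simp: y'_def inj_on_def)
    moreover have "dist (\<Sum>k\<in>F \<union> S'. \<psi> (y' - real_of_int k)) 1 < e / 2"
      using F \<open>finite S'\<close> y' close[rule_format, of "F \<union> S'" y'] by blast
    moreover have "dist (\<Sum>k\<in>F. \<psi> (y' - real_of_int k)) 1 < e / 2"
      using F y' close[rule_format, of F y'] by blast
    ultimately show "(\<Sum>k\<in>S. \<psi> (y - real_of_int k)) \<le> e"
      using split unfolding dist_real_def by linarith
  qed
qed

text \<open>Scaling by \<open>n\<close> turns the distance \<open>d\<close> into
  \<open>n * d\<close>, so a point far from \<open>s\<close> lies in intervals whose index is far
  from \<open>n * s\<close>. The weights of such indices form a tail of the density series.\<close>

lemma kernel_concentration:
  assumes d: "0 < d" and e: "0 < e"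
  shows "\<forall>\<^sub>F n in sequentially. \<forall>s\<in>{-1..1}.
    (\<integral>\<^sup>+ t. kantorovich_kernel n s t * indicator {t. d \<le> \<bar>t - s\<bar>} t \<partial>unif) \<le> ennreal e"
proof -
  \<comment> \<open>The tail is taken below \<open>e * \<psi> 2\<close> because the weights divide
    by a denominator of at least \<open>\<psi> 2\<close>.\<close>
  obtain R where R: "\<And>y S. finite S \<Longrightarrow> (\<And>k. k \<in> S \<Longrightarrow> R \<le> \<bar>y - real_of_int k\<bar>) \<Longrightarrow>
      (\<Sum>k\<in>S. \<psi> (y - real_of_int k)) \<le> e * \<psi> 2"
    using density_tail_small[of "e * \<psi> 2"] e pos by (metis mult_pos_pos)
  \<comment> \<open>The summand 1 is the length of an interval after scaling: \<open>k\<close>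
    differs from \<open>n * t\<close> by at most 1.\<close>
  obtain N :: nat where N: "(R + 1) / d \<le> real N"
    using real_arch_simple by blast
  show ?thesis
  proof (rule eventually_sequentiallyI[of "max 1 N"], intro ballI)
    fix n s assume "max 1 N \<le> n" and s: "s \<in> {-1..1::real}"
    then have n: "n \<ge> 1" and "(R + 1) / d \<le> real n"
      using N by auto
    then have nd: "R + 1 \<le> real n * d"
      using d by (simp add: field_simps)
    define S where "S = {k \<in> {- int n..int n - 1}. R \<le> \<bar>real n * s - real_of_int k\<bar>}"
    have far: "k \<in> S" if "k \<in> {- int n..int n - 1}" "t \<in> interval n k" "d \<le> \<bar>t - s\<bar>" for k t
    proof -
      have "real_of_int k \<le> real n * t" "real n * t \<le> real_of_int k + 1"
        using that(2) n by (auto simp: field_simps)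
      moreover have "real n * d \<le> \<bar>real n * t - real n * s\<bar>"
        using that(3) by (simp add: abs_mult flip: right_diff_distrib) (simp add: mult_left_mono)
      ultimately have "R \<le> \<bar>real n * s - real_of_int k\<bar>"
        using nd by linarith
      with that(1) show ?thesis by (simp add: S_def)
    qed
    have "(\<integral>\<^sup>+ t. kantorovich_kernel n s t * indicator {t. d \<le> \<bar>t - s\<bar>} t \<partial>unif)
        \<le> (\<integral>\<^sup>+ t. (\<Sum>k\<in>S. ennreal (2 * real n * weight n s k) * indicator (interval n k) t) \<partial>unif)"
    proof (intro nn_integral_mono)
      fix t
      show "kantorovich_kernel n s t * indicator {t. d \<le> \<bar>t - s\<bar>} t
          \<le> (\<Sum>k\<in>S. ennreal (2 * real n * weight n s k) * indicator (interval n k) t)"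
      proof (cases "d \<le> \<bar>t - s\<bar>")
        case True
        then have "(\<Sum>k\<in>{- int n..int n - 1}. ennreal (2 * real n * weight n s k) * indicator (interval n k) t)
            = (\<Sum>k\<in>S. ennreal (2 * real n * weight n s k) * indicator (interval n k) t)"
          using far by (intro sum.mono_neutral_right) (auto simp: S_def indicator_def)
        then show ?thesis using s True by (simp add: kantorovich_kernel_def)
      qed simp
    qed
    also have "\<dots> = (\<Sum>k\<in>S. ennreal (2 * real n * weight n s k) * emeasure unif (interval n k))"
      by (rule nn_integral_sum_indicator) simp
    also have "\<dots> = (\<Sum>k\<in>S. ennreal (weight n s k))"
      using n by (intro sum.cong) (auto simp: S_def emeasure_unif_interval weight_nonneg simp flip: ennreal_mult)
    also have "\<dots> \<le> ennreal (\<Sum>k\<in>S. \<psi> (real n * s - real_of_int k) / \<psi> 2)"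
      by (subst sum_ennreal) (auto intro!: ennreal_leI sum_mono weight_le n weight_nonneg simp: s[simplified])
    also have "\<dots> \<le> ennreal e"
    proof (intro ennreal_leI)
      have "finite S"
        by (rule finite_subset[of _ "{- int n..int n - 1}"]) (auto simp: S_def)
      then have "(\<Sum>k\<in>S. \<psi> (real n * s - real_of_int k)) \<le> e * \<psi> 2"
        by (rule R) (auto simp: S_def)
      then show "(\<Sum>k\<in>S. \<psi> (real n * s - real_of_int k) / \<psi> 2) \<le> e"
        using pos by (simp add: field_simps flip: sum_divide_distrib)
    qed
    finally show "(\<integral>\<^sup>+ t. kantorovich_kernel n s t * indicator {t. d \<le> \<bar>t - s\<bar>} t \<partial>unif) \<le> ennreal e" .
  qed
qed

text \<open>The index is shifted because the mass estimates for the kernel are established for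
  \<open>n \<ge> 1\<close>.\<close>

lemma approximate_identity_kantorovich:
  "approximate_identity (\<lambda>n. kantorovich_kernel (Suc n)) (ennreal (2 / \<psi> 2))"
proof (rule approximate_identity.intro)
  fix d e :: real assume "0 < d" "0 < e"
  then show "\<forall>\<^sub>F n in sequentially. \<forall>s\<in>{-1..1}.
      (\<integral>\<^sup>+ t. kantorovich_kernel (Suc n) s t * indicator {t. d \<le> \<bar>t - s\<bar>} t \<partial>unif) \<le> ennreal e"
    using kernel_concentration eventually_sequentially_Suc[of "\<lambda>n. \<forall>s\<in>{-1..1}.
      (\<integral>\<^sup>+ t. kantorovich_kernel n s t * indicator {t. d \<le> \<bar>t - s\<bar>} t \<partial>unif) \<le> ennreal e"] by blast
qed (simp_all add: averaging_kernel_kantorovich)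

end

section \<open>The Kantorovich operators\<close>

context approximate_identity
begin

text \<open>For the truncation \<open>g\<close> and the remainder \<open>h\<close>, an increment of
  \<open>f\<close> is at most
  \<open>\<bar>h y\<bar> + \<bar>h t\<bar> + \<bar>g t - g y\<bar>\<close>. The first two terms are
  bounded uniformly in \<open>n\<close> and determine the level \<open>N\<close>; the third has a
  constant depending on \<open>N\<close> and is made small by \<open>n\<close> afterwards.\<close>

lemma mixint_deviation_small:
  fixes f :: "(nat \<Rightarrow> real) \<Rightarrow> real"
  assumes f [measurable]: "f \<in> borel_measurable (cube_prob r)"
    and q: "\<And>i. i < r \<Longrightarrow> 1 \<le> q i"
    and x: "x \<in> space (cube_prob r)"
    and fin: "mixint q (\<lambda>y. ennreal \<bar>f y\<bar>) r x < \<top>"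
    and e: "0 < e"
  shows "\<exists>n. mixint q (\<lambda>y. averaging_kernel.average (k n) r (\<lambda>t. ennreal \<bar>f t - f y\<bar>) y) r x \<le> ennreal e"
proof -
  have q0: "0 \<le> q i" and q_pos: "0 < q i" if "i < r" for i
    using q[OF that] by auto
  from mixint_add[of r q r, OF q0 order_refl] obtain c1 where c1: "c1 < \<top>"
    and add: "\<And>u v x. u \<in> borel_measurable (cube_prob r) \<Longrightarrow> v \<in> borel_measurable (cube_prob r) \<Longrightarrow>
      x \<in> space (cube_prob r) \<Longrightarrow> mixint q (\<lambda>y. u y + v y) r x \<le> c1 * (mixint q u r x + mixint q v r x)"
    by auto
  from mixint_average_bound[of C r q, OF finite_mass q] obtain c2 where c2: "c2 < \<top>"
    and av: "\<And>n u x. u \<in> borel_measurable (cube_prob r) \<Longrightarrow> x \<in> space (cube_prob r) \<Longrightarrow>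
      mixint q (averaging_kernel.average (k n) r u) r x \<le> c2 * mixint q u r x"
    using kernel by blast
  define g where "g N y = max (- real N) (min (real N) (f y))" for N y
  define h where "h N y = f y - g N y" for N y
  have [measurable]: "g N \<in> borel_measurable (cube_prob r)" "h N \<in> borel_measurable (cube_prob r)" for N
    unfolding g_def[abs_def] h_def[abs_def] by measurable
  have "(\<lambda>N. mixint q (\<lambda>y. ennreal \<bar>h N y\<bar>) r x) \<longlonglongrightarrow> 0"
  proof (rule mixint_tendsto_0[where j=r and q=q, OF _ _ _ _ q_pos order_refl x fin])
    show "ennreal \<bar>h N y\<bar> \<le> ennreal \<bar>f y\<bar>" for N y
      by (intro ennreal_leI) (auto simp: h_def g_def)
    show "(\<lambda>N. ennreal \<bar>h N y\<bar>) \<longlonglongrightarrow> 0" for y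
    proof (rule tendsto_eventually)
      obtain N0 :: nat where "\<bar>f y\<bar> \<le> real N0"
        using real_arch_simple by blast
      then show "\<forall>\<^sub>F N in sequentially. ennreal \<bar>h N y\<bar> = 0"
        by (intro eventually_sequentiallyI[of N0]) (auto simp: h_def g_def)
    qed
  qed auto
  \<comment> \<open>The remainder enters twice: directly, after one use of \<open>add\<close>, and
    under the average, after two uses of \<open>add\<close> and with the factor
    \<open>c2\<close>.\<close>
  then have "(\<lambda>N. (c1 + c1 * (c1 * c2)) * mixint q (\<lambda>y. ennreal \<bar>h N y\<bar>) r x) \<longlonglongrightarrow> (c1 + c1 * (c1 * c2)) * 0"
    using c1 c2 by (intro ennreal_tendsto_cmult) (auto simp: ennreal_mult_less_top)
  then have "\<forall>\<^sub>F N in sequentially. (c1 + c1 * (c1 * c2)) * mixint q (\<lambda>y. ennreal \<bar>h N y\<bar>) r x \<le> ennreal (e / 2)"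
    using e by (intro ennreal_tendsto_0D) auto
  then obtain N where N: "(c1 + c1 * (c1 * c2)) * mixint q (\<lambda>y. ennreal \<bar>h N y\<bar>) r x \<le> ennreal (e / 2)"
    by (auto simp: eventually_sequentially)
  define G where "G n y = averaging_kernel.average (k n) r (\<lambda>t. ennreal \<bar>g N t - g N y\<bar>) y" for n y
  have G [measurable]: "G n \<in> borel_measurable (cube_prob r)" for n
    unfolding G_def[abs_def] by (intro averaging_kernel.measurable_average_pair[OF kernel]) measurable
  have G_le: "G n y \<le> ennreal (2 * real N)" if "y \<in> space (cube_prob r)" for n y
  proof -
    have "G n y \<le> averaging_kernel.average (k n) r (\<lambda>t. ennreal (2 * real N)) y"
      unfolding G_def by (intro averaging_kernel.average_mono[OF kernel] ennreal_leI) (auto simp: g_def)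
    then show ?thesis
      using averaging_kernel.average_const[OF kernel that] by simp
  qed
  \<comment> \<open>The values of \<open>g N\<close> lie in an interval of length
    \<open>2 * N\<close>, which bounds its averaged increments; hence \<open>c3\<close> depends on
    \<open>N\<close>.\<close>
  have "0 \<le> 2 * real N" by simp
  from mixint_le_linear[of r q r, OF q order_refl this] obtain c3 where c3: "c3 < \<top>"
    and lin: "\<And>u x. u \<in> borel_measurable (cube_prob r) \<Longrightarrow> \<forall>x\<in>space (cube_prob r). u x \<le> ennreal (2 * real N) \<Longrightarrow>
      x \<in> space (cube_prob r) \<Longrightarrow> mixint q u r x \<le> c3 * mixint (\<lambda>_. 1) u r x"
    by blast
  have "integrable (cube_prob r) (g N)"
    by (rule cube.integrable_const_bound[where B="real N"]) (auto simp: g_def)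
  then have "(\<lambda>n. c1 * (c1 * (c3 * 2 ^ r)) * disp n r (g N)) \<longlonglongrightarrow> c1 * (c1 * (c3 * 2 ^ r)) * 0"
    using c1 c3 by (intro ennreal_tendsto_cmult disp_tendsto_0) (auto simp: ennreal_mult_less_top power_less_top_ennreal)
  then have "\<forall>\<^sub>F n in sequentially. c1 * (c1 * (c3 * 2 ^ r)) * disp n r (g N) \<le> ennreal (e / 2)"
    using e by (intro ennreal_tendsto_0D) auto
  then obtain n where n: "c1 * (c1 * (c3 * 2 ^ r)) * disp n r (g N) \<le> ennreal (e / 2)"
    by (auto simp: eventually_sequentially)
  let ?H = "\<lambda>y. ennreal \<bar>h N y\<bar>"
  let ?A = "averaging_kernel.average (k n) r"
  have mA [measurable]: "?A ?H \<in> borel_measurable (cube_prob r)"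
    by (intro averaging_kernel.measurable_average_pair[OF kernel]) measurable
  have "mixint q (\<lambda>y. ?A (\<lambda>t. ennreal \<bar>f t - f y\<bar>) y) r x \<le> mixint q (\<lambda>y. ?H y + (?A ?H y + G n y)) r x"
  proof (rule mixint_mono[where j=r and q=q, OF _ q0 order_refl x])
    fix y assume y: "y \<in> space (cube_prob r)"
    have "?A (\<lambda>t. ennreal \<bar>f t - f y\<bar>) y \<le> ?A (\<lambda>t. ?H y + (?H t + ennreal \<bar>g N t - g N y\<bar>)) y"
      by (intro averaging_kernel.average_mono[OF kernel])
        (auto simp: h_def intro!: ennreal_leI simp flip: ennreal_plus)
    also have "\<dots> = ?H y + (?A ?H y + G n y)"
      using y by (simp add: averaging_kernel.average_add[OF kernel] averaging_kernel.average_const[OF kernel] G_def)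
    finally show "?A (\<lambda>t. ennreal \<bar>f t - f y\<bar>) y \<le> ?H y + (?A ?H y + G n y)" .
  qed
  also have "\<dots> \<le> c1 * (mixint q ?H r x + mixint q (\<lambda>y. ?A ?H y + G n y) r x)"
    by (intro add x) measurable
  also have "\<dots> \<le> c1 * (mixint q ?H r x + c1 * (mixint q (?A ?H) r x + mixint q (G n) r x))"
    by (intro mult_left_mono add_left_mono add x) measurable
  also have "\<dots> \<le> c1 * (mixint q ?H r x + c1 * (c2 * mixint q ?H r x + c3 * (2 ^ r * disp n r (g N))))"
  proof (intro mult_left_mono add_left_mono add_mono)
    show "mixint q (?A ?H) r x \<le> c2 * mixint q ?H r x"
      by (intro av x) measurable
    have "mixint q (G n) r x \<le> c3 * mixint (\<lambda>_. 1) (G n) r x"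
      using G_le by (intro lin x G) auto
    also have "mixint (\<lambda>_. 1) (G n) r x = 2 ^ r * disp n r (g N)"
      unfolding mixint_1_top[OF G x] averaging_kernel.dispersion_def[OF kernel] G_def ..
    finally show "mixint q (G n) r x \<le> c3 * (2 ^ r * disp n r (g N))" .
  qed auto
  also have "\<dots> = (c1 + c1 * (c1 * c2)) * mixint q ?H r x + c1 * (c1 * (c3 * 2 ^ r)) * disp n r (g N)"
    by (simp add: distrib_left distrib_right mult.assoc add.assoc)
  also have "\<dots> \<le> ennreal (e / 2) + ennreal (e / 2)"
    by (intro add_mono N n)
  also have "\<dots> = ennreal e"
    using e by (simp flip: ennreal_plus)
  finally show ?thesis ..
qed

end

text \<open>A null set may have sections that are not null. The induction is confined to points
  \<open>x\<close> at which the iterated measure of the exceptional set,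
  \<open>mixint (\<lambda>_. 1) (indicator N) j x\<close>, vanishes; by Tonelli's theorem it does
  vanish at the last stage. This admits a \<open>g\<close> that is not Borel.\<close>

lemma mixed_integral_eq_mixint:
  assumes v: "v \<in> borel_measurable (cube_prob r)"
    and ae: "AE x in cube_prob r. ennreal \<bar>g x\<bar> = v x"
  shows "mixed_integral p g r (\<lambda>_. undefined)
    = mixint (\<lambda>j. if j = 0 then p 1 else p (Suc j) / p j) v r (\<lambda>_. undefined)"
proof -
  define q where "q j = (if j = 0 then p 1 else p (Suc j) / p j)" for j
  obtain N where N: "N \<in> null_sets (cube_prob r)"
    and eq: "\<And>x. x \<in> space (cube_prob r) - N \<Longrightarrow> ennreal \<bar>g x\<bar> = v x"
    using AE_E3[OF ae] by blast
  have N_meas [measurable]: "(indicator N :: _ \<Rightarrow> ennreal) \<in> borel_measurable (cube_prob r)"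
    using N by auto
  have "mixed_integral p g j x = mixint q v j x"
    if "j \<le> r" "x \<in> space (cube_prob r)" "mixint (\<lambda>_. 1) (indicator N) j x = 0" for j x
    using that
  proof (induction j arbitrary: x)
    case 0
    then show ?case using eq[of x] by (auto simp: indicator_def split: if_splits)
  next
    case (Suc j)
    note meas = measurable_mixint_section[OF _ Suc.prems(1,2)]
    have "AE t in unif. mixint (\<lambda>_. 1) (indicator N) j (x(Suc j := t)) = 0"
      using Suc.prems(3) by (subst nn_integral_0_iff_AE[symmetric]) (auto intro!: meas)
    then have "AE t in unif. mixed_integral p g j (x(Suc j := t)) = mixint q v j (x(Suc j := t))"
    proof eventually_elim
      case (elim t)
      with Suc.prems show ?case
        by (intro Suc.IH cube_upd_in_space) (auto simp del: fun_upd_apply)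
    qed
    then have ae: "AE t in lborel. t \<in> {-1..1} \<longrightarrow> mixed_integral p g j (x(Suc j := t)) = mixint q v j (x(Suc j := t))"
      by (simp only: AE_unif)
    \<comment> \<open>Sections of \<open>mixed_integral\<close> are not known to be measurable. Both
      the passage from \<open>lebesgue\<close> to \<open>lborel\<close> and the replacement almost
      everywhere are valid for arbitrary functions.\<close>
    have "mixed_integral p g (Suc j) x
        = (\<integral>\<^sup>+ t\<in>{-1..1}. ennreal_powr (mixed_integral p g j (x(Suc j := t))) (q j) \<partial>lborel)"
      by (simp add: nn_integral_completion q_def)
    also have "\<dots> = (\<integral>\<^sup>+ t\<in>{-1..1}. ennreal_powr (mixint q v j (x(Suc j := t))) (q j) \<partial>lborel)"
    proof (rule nn_integral_cong_AE)
      show "AE t in lborel. ennreal_powr (mixed_integral p g j (x(Suc j := t))) (q j) * indicator {-1..1} t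
          = ennreal_powr (mixint q v j (x(Suc j := t))) (q j) * indicator {-1..1} t"
        using ae by eventually_elim (auto simp: indicator_def)
    qed
    also have "\<dots> = mixint q v (Suc j) x"
      using meas[OF v, of q] by (simp add: nn_integral_unif measurable_ennreal_powr cong: measurable_cong_sets)
    finally show ?case .
  qed
  moreover have "mixint (\<lambda>_. 1) (indicator N) r (\<lambda>_. undefined) = 0"
    using N by (subst mixint_1_top[OF N_meas]) (simp_all add: null_setsD1 null_setsD2)
  ultimately show ?thesis
    by (simp add: q_def[abs_def])
qed

section \<open>Cells of the grid and Borel representatives\<close>

lemma cell_in_sets [measurable]: "cell r k n \<in> sets (Pi\<^sub>M {1..r} (\<lambda>_. lborel))"
  unfolding cell_def by (intro sets_PiM_I_finite) auto

lemma emeasure_cell: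
  assumes "n \<ge> 1"
  shows "emeasure (Pi\<^sub>M {1..r} (\<lambda>_. lborel)) (cell r k n) = ennreal (1 / real n ^ r)"
proof -
  interpret lb: product_sigma_finite "\<lambda>_::nat. lborel::real measure"
    by standard
  have "emeasure (Pi\<^sub>M {1..r} (\<lambda>_. lborel)) (cell r k n)
      = (\<Prod>j\<in>{1..r}. emeasure lborel {real_of_int (k j) / real n..(real_of_int (k j) + 1) / real n})"
    unfolding cell_def by (intro lb.emeasure_PiM) auto
  also have "\<dots> = (\<Prod>j\<in>{1..r}. ennreal (1 / real n))"
    using assms by (intro prod.cong) (auto simp: emeasure_lborel_Icc_eq divide_right_mono diff_divide_distrib[symmetric])
  also have "\<dots> = ennreal (1 / real n ^ r)"
    by (simp add: ennreal_power power_one_over)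
  finally show ?thesis .
qed

lemma cell_subset_cube:
  assumes "n \<ge> 1" "k \<in> grid r n"
  shows "cell r k n \<subseteq> cube r"
  unfolding cell_def cube_def
proof (rule PiE_mono)
  fix j assume "j \<in> {1..r}"
  then have "k j \<in> {- int n..int n - 1}"
    using assms(2) by (auto simp: grid_def)
  then have "- real n \<le> real_of_int (k j)" "real_of_int (k j) + 1 \<le> real n"
    by auto
  then show "{real_of_int (k j) / real n..(real_of_int (k j) + 1) / real n} \<subseteq> {-1..1}"
    using assms(1) by (auto simp: field_simps intro: order_trans)
qed

text \<open>The operator sees \<open>f\<close> only through integrals over cells inside the cube, so
  a change on a null set leaves its values the same at every point, not just almost everywhere. The
  representative is found for the extension of \<open>f\<close> by 0, which is measurable for the
  completed measure.\<close>

lemma borel_representative: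
  fixes f :: "(nat \<Rightarrow> real) \<Rightarrow> real"
  assumes "f \<in> borel_measurable (restrict_space (lebesgue_space r) (cube r))"
  obtains g where "g \<in> borel_measurable (cube_prob r)" "AE x in cube_prob r. f x = g x"
    "\<And>n x. n \<ge> 1 \<Longrightarrow> kantorovich_op r \<rho> n f x = kantorovich_op r \<rho> n g x"
proof -
  let ?L = "Pi\<^sub>M {1..r} (\<lambda>_. lborel) :: (nat \<Rightarrow> real) measure"
  have "cube r \<inter> space (completion ?L) \<in> sets (completion ?L)"
    unfolding space_completion by (intro sets_completionI_sets sets.Int cube_in_sets sets.top)
  then have meas: "(\<lambda>x. indicator (cube r) x *\<^sub>R f x) \<in> borel_measurable (completion ?L)"
    using assms unfolding lebesgue_space_def by (simp only: borel_measurable_restrict_space_iff)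
  from completion_ex_borel_measurable_real[OF meas] obtain g
    where g [measurable]: "g \<in> borel_measurable ?L" and ae: "AE x in ?L. indicator (cube r) x *\<^sub>R f x = g x"
    by blast
  show thesis
  proof (rule that)
    show "g \<in> borel_measurable (cube_prob r)"
      using g by (simp only: borel_measurable_cube_prob)
    show "AE x in cube_prob r. f x = g x"
      unfolding AE_cube_prob using ae by eventually_elim (auto simp: indicator_def)
    fix n :: nat and x assume n: "n \<ge> 1"
    have "(LINT t:cell r k n|lebesgue_space r. f t) = (LINT t:cell r k n|lebesgue_space r. g t)"
      if k: "k \<in> grid r n" for k
    proof -
      have "(LINT t:cell r k n|lebesgue_space r. f t)
          = (LINT t|completion ?L. indicator (cell r k n) t *\<^sub>R (indicator (cube r) t *\<^sub>R f t))"
        unfolding set_lebesgue_integral_def lebesgue_space_def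
        using cell_subset_cube[OF n k] by (intro Bochner_Integration.integral_cong) (auto simp: indicator_def)
      also have "\<dots> = (LINT t|completion ?L. indicator (cell r k n) t *\<^sub>R g t)"
      proof (rule integral_cong_AE)
        have "cell r k n \<in> sets (completion ?L)"
          by (rule sets_completionI_sets) measurable
        then show "(\<lambda>t. indicator (cell r k n) t *\<^sub>R (indicator (cube r) t *\<^sub>R f t)) \<in> borel_measurable (completion ?L)"
          by (intro borel_measurable_scaleR[OF _ meas] borel_measurable_indicator)
        show "(\<lambda>t. indicator (cell r k n) t *\<^sub>R g t) \<in> borel_measurable (completion ?L)"
          by (rule measurable_completion) measurable
        show "AE t in completion ?L. indicator (cell r k n) t *\<^sub>R (indicator (cube r) t *\<^sub>R f t) = indicator (cell r k n) t *\<^sub>R g t"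
          using AE_completion[OF ae] by eventually_elim simp
      qed
      finally show ?thesis
        unfolding set_lebesgue_integral_def lebesgue_space_def .
    qed
    then show "kantorovich_op r \<rho> n f x = kantorovich_op r \<rho> n g x"
      unfolding kantorovich_op_def by (simp cong: sum.cong)
  qed
qed

lemma measurable_kantorovich_op:
  assumes [measurable]: "uni_density \<rho> \<in> borel_measurable borel"
  shows "kantorovich_op r \<rho> n f \<in> borel_measurable (cube_prob r)"
proof -
  have [measurable]: "(\<lambda>x. multi_density r \<rho> (\<lambda>j. real n * x j - real_of_int (k j))) \<in> borel_measurable (cube_prob r)" for k
    unfolding multi_density_def
  proof (intro borel_measurable_prod)
    fix j assume "j \<in> {1..r}"
    from measurable_cube_component[OF this]
    show "(\<lambda>x. uni_density \<rho> (real n * x j - real_of_int (k j))) \<in> borel_measurable (cube_prob r)"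
      by measurable
  qed
  show ?thesis
    unfolding kantorovich_op_def[abs_def] by measurable
qed

section \<open>The operator as an average against the tensor kernel\<close>

context density_function
begin

lemma sum_grid_weight:
  assumes "n \<ge> 1" "x \<in> cube r"
  shows "(\<Sum>k\<in>grid r n. \<Prod>j\<in>{1..r}. weight n (x j) (k j)) = 1"
proof -
  have "(\<Sum>k\<in>grid r n. \<Prod>j\<in>{1..r}. weight n (x j) (k j))
      = (\<Prod>j\<in>{1..r}. \<Sum>k\<in>{- int n..int n - 1}. weight n (x j) k)"
    unfolding grid_def by (rule prod_sum_PiE[symmetric]) auto
  also have "\<dots> = 1"
    using assms by (intro prod.neutral ballI sum_weight) (auto simp: cube_def)
  finally show ?thesis .
qed

text \<open>The grid is a product and the density a tensor product, so the denominator factorises by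
  distributivity and is shared out among the coordinates.\<close>

lemma kantorovich_op_eq:
  assumes \<rho>: "uni_density \<rho> = \<psi>"
  shows "kantorovich_op r \<rho> n f x = (\<Sum>k\<in>grid r n.
    (real n ^ r * (LINT t:cell r k n|lebesgue_space r. f t)) * (\<Prod>j\<in>{1..r}. weight n (x j) (k j)))"
proof -
  have "(\<Sum>k\<in>grid r n. multi_density r \<rho> (\<lambda>j. real n * x j - real_of_int (k j)))
      = (\<Prod>j\<in>{1..r}. denominator n (x j))"
    unfolding grid_def multi_density_def \<rho> denominator_def by (rule prod_sum_PiE[symmetric]) auto
  then show ?thesis
    unfolding kantorovich_op_def
    by (simp add: sum_divide_distrib multi_density_def \<rho> weight_def prod_dividef)
qed

text \<open>Expanding the product of sums gives one term for each multi-index. The factor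
  \<open>2 ^ r * n ^ r\<close> is the reciprocal of the normalised measure of a cell.\<close>

lemma prod_kernel_kantorovich:
  assumes "n \<ge> 1" "x \<in> cube r" "t \<in> space (cube_prob r)"
  shows "averaging_kernel.prod_kernel (kantorovich_kernel n) r 0 x t
    = (\<Sum>k\<in>grid r n. ennreal (\<Prod>j\<in>{1..r}. weight n (x j) (k j)) * (2 ^ r * (ennreal (real n ^ r) * indicator (cell r k n) t)))"
proof -
  have "averaging_kernel.prod_kernel (kantorovich_kernel n) r 0 x t
      = (\<Prod>i\<in>{1..r}. \<Sum>k\<in>{- int n..int n - 1}. ennreal (2 * real n * weight n (x i) k) * indicator (interval n k) (t i))"
    unfolding averaging_kernel.prod_kernel_def[OF averaging_kernel_kantorovich[OF assms(1)]] kantorovich_kernel_def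
    using assms(2) by (intro prod.cong) (auto simp: cube_def PiE_iff)
  also have "\<dots> = (\<Sum>k\<in>grid r n. \<Prod>i\<in>{1..r}. ennreal (2 * real n * weight n (x i) (k i)) * indicator (interval n (k i)) (t i))"
    unfolding grid_def by (rule prod_sum_PiE) auto
  also have "\<dots> = (\<Sum>k\<in>grid r n. ennreal (\<Prod>j\<in>{1..r}. weight n (x j) (k j)) * (2 ^ r * (ennreal (real n ^ r) * indicator (cell r k n) t)))"
  proof (intro sum.cong refl)
    fix k
    have "(\<Prod>i\<in>{1..r}. indicator (interval n (k i)) (t i) :: ennreal) = indicator (cell r k n) t"
    proof (cases "t \<in> cell r k n")
      case True
      then have "t i \<in> interval n (k i)" if "i \<in> {1..r}" for i
        using that unfolding cell_def by (rule PiE_mem)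
      with True show ?thesis
        by (simp add: indicator_def prod.neutral)
    next
      case False
      \<comment> \<open>A point of the space is extensional, so lying outside the cell shows in a
        coordinate from \<open>{1..r}\<close>.\<close>
      then obtain i where "i \<in> {1..r}" "t i \<notin> interval n (k i)"
        using assms(3) by (auto simp: cell_def space_cube_prob PiE_iff)
      then have "(\<Prod>i\<in>{1..r}. indicator (interval n (k i)) (t i) :: ennreal) = 0"
        by (intro prod_zero bexI[of _ i]) simp_all
      with False show ?thesis by simp
    qed
    moreover have "(\<Prod>i\<in>{1..r}. ennreal (2 * real n * weight n (x i) (k i)))
        = ennreal (\<Prod>i\<in>{1..r}. weight n (x i) (k i)) * (2 ^ r * ennreal (real n ^ r))"
    proof -
      have "(\<Prod>i\<in>{1..r}. ennreal (2 * real n * weight n (x i) (k i)))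
          = (\<Prod>i\<in>{1..r}. ennreal (weight n (x i) (k i)) * (2 * ennreal (real n)))"
        by (intro prod.cong) (auto simp: ennreal_mult weight_nonneg mult_ac)
      then show ?thesis
        by (simp add: prod.distrib prod_ennreal weight_nonneg power_mult_distrib ennreal_power)
    qed
    ultimately show "(\<Prod>i\<in>{1..r}. ennreal (2 * real n * weight n (x i) (k i)) * indicator (interval n (k i)) (t i))
        = ennreal (\<Prod>j\<in>{1..r}. weight n (x j) (k j)) * (2 ^ r * (ennreal (real n ^ r) * indicator (cell r k n) t))"
      by (simp add: prod.distrib mult.assoc)
  qed
  finally show ?thesis .
qed

text \<open>The average is the operator with nonnegative integrals over the cells; the factor
  \<open>2 ^ r\<close> of the kernel cancels the normalisation of \<open>cube_prob\<close>.\<close>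

lemma average_kantorovich:
  assumes n: "n \<ge> 1" and x: "x \<in> cube r" and u: "u \<in> borel_measurable (cube_prob r)"
  shows "averaging_kernel.average (kantorovich_kernel n) r u x
    = (\<Sum>k\<in>grid r n. ennreal (\<Prod>j\<in>{1..r}. weight n (x j) (k j)) *
        (ennreal (real n ^ r) * (\<integral>\<^sup>+ t\<in>cell r k n. u t \<partial>Pi\<^sub>M {1..r} (\<lambda>_. lborel))))"
proof -
  let ?w = "\<lambda>k. ennreal (\<Prod>j\<in>{1..r}. weight n (x j) (k j))"
  have m [measurable]: "(\<lambda>t. u t * indicator (cell r k n) t) \<in> borel_measurable (cube_prob r)" for k
    by (intro borel_measurable_times_ennreal u borel_measurable_indicator)
      (simp only: sets_cube_prob cell_in_sets)
  have "averaging_kernel.average (kantorovich_kernel n) r u x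
      = (\<integral>\<^sup>+ t. (\<Sum>k\<in>grid r n. ?w k * (2 ^ r * (ennreal (real n ^ r) * (u t * indicator (cell r k n) t)))) \<partial>cube_prob r)"
    unfolding averaging_kernel.average_def[OF averaging_kernel_kantorovich[OF n]]
    by (intro nn_integral_cong)
      (simp only: prod_kernel_kantorovich[OF n x] sum_distrib_right mult.assoc mult.commute[of "indicator _ _"])
  also have "\<dots> = (\<Sum>k\<in>grid r n. \<integral>\<^sup>+ t. ?w k * (2 ^ r * (ennreal (real n ^ r) * (u t * indicator (cell r k n) t))) \<partial>cube_prob r)"
    by (rule nn_integral_sum) measurable
  also have "\<dots> = (\<Sum>k\<in>grid r n. ?w k * (ennreal (real n ^ r) * (\<integral>\<^sup>+ t\<in>cell r k n. u t \<partial>Pi\<^sub>M {1..r} (\<lambda>_. lborel))))"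
  proof (intro sum.cong refl)
    fix k assume k: "k \<in> grid r n"
    have "(\<integral>\<^sup>+ t. ?w k * (2 ^ r * (ennreal (real n ^ r) * (u t * indicator (cell r k n) t))) \<partial>cube_prob r)
        = ?w k * (2 ^ r * (ennreal (real n ^ r) * (\<integral>\<^sup>+ t. u t * indicator (cell r k n) t \<partial>cube_prob r)))"
      by (simp add: nn_integral_cmult)
    also have "\<dots> = ?w k * (ennreal (real n ^ r) * (2 ^ r * (\<integral>\<^sup>+ t. u t * indicator (cell r k n) t \<partial>cube_prob r)))"
      by (simp only: mult.left_commute)
    also have "2 ^ r * (\<integral>\<^sup>+ t. u t * indicator (cell r k n) t \<partial>cube_prob r)
        = (\<integral>\<^sup>+ t\<in>cell r k n. u t \<partial>Pi\<^sub>M {1..r} (\<lambda>_. lborel))"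
      unfolding nn_integral_cube_prob[OF m]
      using cell_subset_cube[OF n k] by (intro nn_integral_cong) (auto simp: indicator_def)
    finally show "(\<integral>\<^sup>+ t. ?w k * (2 ^ r * (ennreal (real n ^ r) * (u t * indicator (cell r k n) t))) \<partial>cube_prob r)
        = ?w k * (ennreal (real n ^ r) * (\<integral>\<^sup>+ t\<in>cell r k n. u t \<partial>Pi\<^sub>M {1..r} (\<lambda>_. lborel)))" .
  qed
  finally show ?thesis .
qed

text \<open>The weights sum to 1, so \<open>f x\<close> can be distributed over the cells. What
  remains is the deviation of \<open>f x\<close> from each cell mean, which
  \<open>mean_deviation_le\<close> bounds even where \<open>f\<close> fails to be integrable on the
  cell.\<close>

lemma kantorovich_deviation_le:
  assumes \<rho>: "uni_density \<rho> = \<psi>" and n: "n \<ge> 1" and x: "x \<in> cube r"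
    and f: "f \<in> borel_measurable (cube_prob r)"
  shows "ennreal \<bar>f x - kantorovich_op r \<rho> n f x\<bar>
    \<le> averaging_kernel.average (kantorovich_kernel n) r (\<lambda>t. ennreal \<bar>f t - f x\<bar>) x"
proof -
  let ?L = "Pi\<^sub>M {1..r} (\<lambda>_. lborel) :: (nat \<Rightarrow> real) measure"
  let ?w = "\<lambda>k. \<Prod>j\<in>{1..r}. weight n (x j) (k j)"
  let ?m = "\<lambda>k. real n ^ r * (LINT t:cell r k n|lebesgue_space r. f t)"
  have fL [measurable]: "f \<in> borel_measurable ?L"
    using f by (simp only: borel_measurable_cube_prob)
  have w: "0 \<le> ?w k" for k
    by (intro prod_nonneg ballI weight_nonneg)
  have "f x = (\<Sum>k\<in>grid r n. f x * ?w k)"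
    using sum_grid_weight[OF n x] by (simp flip: sum_distrib_left)
  then have "f x - kantorovich_op r \<rho> n f x = (\<Sum>k\<in>grid r n. (f x - ?m k) * ?w k)"
    unfolding kantorovich_op_eq[OF \<rho>] by (simp only: left_diff_distrib sum_subtractf)
  then have "\<bar>f x - kantorovich_op r \<rho> n f x\<bar> \<le> (\<Sum>k\<in>grid r n. \<bar>f x - ?m k\<bar> * ?w k)"
    using sum_abs[of "\<lambda>k. (f x - ?m k) * ?w k" "grid r n"] w by (simp add: abs_mult)
  then have "ennreal \<bar>f x - kantorovich_op r \<rho> n f x\<bar> \<le> ennreal (\<Sum>k\<in>grid r n. \<bar>f x - ?m k\<bar> * ?w k)"
    by (rule ennreal_leI)
  also have "\<dots> = (\<Sum>k\<in>grid r n. ennreal (?w k) * ennreal \<bar>f x - ?m k\<bar>)"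
    using w by (subst sum_ennreal[symmetric]) (auto simp: ennreal_mult mult.commute)
  also have "\<dots> \<le> (\<Sum>k\<in>grid r n. ennreal (?w k) * (ennreal (real n ^ r) * (\<integral>\<^sup>+ t\<in>cell r k n. ennreal \<bar>f t - f x\<bar> \<partial>?L)))"
  proof (intro sum_mono mult_left_mono)
    fix k
    have "(LINT t:cell r k n|lebesgue_space r. f t) = (LINT t:cell r k n|?L. f t)"
      unfolding set_lebesgue_integral_def lebesgue_space_def by (rule integral_completion) measurable
    then show "ennreal \<bar>f x - ?m k\<bar> \<le> ennreal (real n ^ r) * (\<integral>\<^sup>+ t\<in>cell r k n. ennreal \<bar>f t - f x\<bar> \<partial>?L)"
      using mean_deviation_le[OF fL cell_in_sets emeasure_cell[OF n], of "f x" k] n by simp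
  qed simp
  also have "\<dots> = averaging_kernel.average (kantorovich_kernel n) r (\<lambda>t. ennreal \<bar>f t - f x\<bar>) x"
  proof (rule average_kantorovich[OF n x, symmetric])
    have "(\<lambda>t. ennreal \<bar>f t - c\<bar>) \<in> borel_measurable (cube_prob r)" for c
      using f by measurable
    then show "(\<lambda>t. ennreal \<bar>f t - f x\<bar>) \<in> borel_measurable (cube_prob r)" .
  qed
  finally show ?thesis .
qed

end

section \<open>Convergence in the mixed norm\<close>

theorem theorem3p5:
  fixes \<rho> :: "real \<Rightarrow> real" and \<eta> :: real
    and r :: nat and p :: "nat \<Rightarrow> real" and f :: "(nat \<Rightarrow> real) \<Rightarrow> real"
    and \<epsilon> :: real
  assumes "mono \<rho>" and "sigmoidal \<rho>"
    and "\<eta> > 1"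
    and "uni_density \<rho> \<in> O[at_top](\<lambda>x. \<bar>x\<bar> powr (-\<eta>))"
    and "uni_density \<rho> \<in> O[at_bot](\<lambda>x. \<bar>x\<bar> powr (-\<eta>))"
    and "has_bochner_integral lborel (uni_density \<rho>) 1"
    and "\<And>x. ((\<lambda>k::int. uni_density \<rho> (x - real_of_int k)) has_sum 1) UNIV"
    and "\<And>S. compact S \<Longrightarrow>
           uniform_limit S (\<lambda>F x. \<Sum>k\<in>F. uni_density \<rho> (x - real_of_int k)) (\<lambda>_. 1)
             (finite_subsets_at_top UNIV)"
    and "\<And>n x. n \<ge> 1 \<Longrightarrow> x \<in> {-1..1} \<Longrightarrow>
           (\<Sum>k\<in>{- int n..int n - 1}. uni_density \<rho> (real n * x - real_of_int k)) \<ge> uni_density \<rho> 2"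
    and "uni_density \<rho> 2 > 0"
    and "r \<ge> 1"
    and "1 \<le> p 1" and "mono_on {1..r} p"
    and "f \<in> mixed_Lp r p"
    and "\<epsilon> > 0"
  shows "\<exists>n\<ge>1. mixed_norm r p (\<lambda>x. f x - kantorovich_op r \<rho> n f x) < ennreal \<epsilon>"
proof -
  interpret density_function "uni_density \<rho>"
  proof
    show "0 \<le> uni_density \<rho> x" for x
      using monoD[OF assms(1), of "x - 1" "x + 1"] by (simp add: uni_density_def)
  qed (use assms(6,8-10) in auto)
  interpret approximate_identity "\<lambda>n. kantorovich_kernel (Suc n)" "ennreal (2 / uni_density \<rho> 2)"
    by (rule approximate_identity_kantorovich)
  define q where "q j = (if j = 0 then p 1 else p (Suc j) / p j)" for j
  have p: "1 \<le> p j" if "j \<in> {1..r}" for j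
    using mono_onD[OF assms(13), of 1 j] assms(12) that by auto
  have q: "1 \<le> q j" if "j < r" for j
    using p[of j] mono_onD[OF assms(13), of j "Suc j"] assms(12) that by (auto simp: q_def)
  have pr: "1 \<le> p r" using p[of r] assms(11) by auto
  let ?o = "\<lambda>_::nat. undefined :: real"
  have "f \<in> borel_measurable (restrict_space (lebesgue_space r) (cube r))"
    using assms(14) by (simp add: mixed_Lp_def)
  then obtain g where g [measurable]: "g \<in> borel_measurable (cube_prob r)"
    and ae: "AE x in cube_prob r. f x = g x"
    and K: "\<And>n x. n \<ge> 1 \<Longrightarrow> kantorovich_op r \<rho> n f x = kantorovich_op r \<rho> n g x"
    by (rule borel_representative[where \<rho>=\<rho>]) (rule that)
  have "mixed_integral p f r ?o = mixint q (\<lambda>x. ennreal \<bar>g x\<bar>) r ?o"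
    unfolding q_def using ae by (intro mixed_integral_eq_mixint) auto
  moreover have "mixed_integral p f r ?o < \<top>"
    using assms(14) by (simp add: mixed_Lp_def mixed_norm_def ennreal_powr_less_top_iff)
  ultimately have fin: "mixint q (\<lambda>x. ennreal \<bar>g x\<bar>) r ?o < \<top>" by simp
  \<comment> \<open>The power undoes the outer root \<open>1 / p r\<close>; halving leaves room for
    the strict inequality.\<close>
  define e where "e = (\<epsilon> / 2) powr p r"
  have "0 < e" using assms(15) by (simp add: e_def)
  from mixint_deviation_small[OF g q undefined_in_cube_prob fin this] obtain n where
    n: "mixint q (\<lambda>y. averaging_kernel.average (kantorovich_kernel (Suc n)) r (\<lambda>t. ennreal \<bar>g t - g y\<bar>) y) r ?o \<le> ennreal e"
    by blast
  \<comment> \<open>The kernel bound holds on the cube. The indicator changes nothing almost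
    everywhere and yields a domination at every point, as \<open>mixint_mono\<close>
    demands.\<close>
  let ?v = "\<lambda>x. indicator (cube r) x * ennreal \<bar>g x - kantorovich_op r \<rho> (Suc n) g x\<bar>"
  have [measurable]: "kantorovich_op r \<rho> (Suc n) g \<in> borel_measurable (cube_prob r)"
    by (intro measurable_kantorovich_op measurable_density)
  have [measurable]: "cube r \<in> sets (cube_prob r)"
    using cube_in_sets by (simp only: sets_cube_prob)
  have "AE x in cube_prob r. x \<in> cube r"
    by (simp add: AE_cube_prob)
  with ae have "AE x in cube_prob r. ennreal \<bar>f x - kantorovich_op r \<rho> (Suc n) f x\<bar> = ?v x"
    by eventually_elim (simp add: K)
  then have "mixed_integral p (\<lambda>x. f x - kantorovich_op r \<rho> (Suc n) f x) r ?o = mixint q ?v r ?o"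
    unfolding q_def by (intro mixed_integral_eq_mixint) measurable
  also have "\<dots> \<le> mixint q (\<lambda>y. averaging_kernel.average (kantorovich_kernel (Suc n)) r (\<lambda>t. ennreal \<bar>g t - g y\<bar>) y) r ?o"
  proof (rule mixint_mono)
    show "0 \<le> q i" if "i < r" for i
      using q[OF that] by simp
    show "?v y \<le> averaging_kernel.average (kantorovich_kernel (Suc n)) r (\<lambda>t. ennreal \<bar>g t - g y\<bar>) y" for y
      using kantorovich_deviation_le[OF refl, of "Suc n" y r g] g by (cases "y \<in> cube r") auto
  qed auto
  also note n
  finally have "mixed_norm r p (\<lambda>x. f x - kantorovich_op r \<rho> (Suc n) f x) \<le> ennreal_powr (ennreal e) (1 / p r)"
    unfolding mixed_norm_def using pr by (intro ennreal_powr_mono) auto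
  also have "\<dots> = ennreal (\<epsilon> / 2)"
    using pr assms(15) by (simp add: ennreal_powr_of_ennreal e_def powr_powr)
  also have "\<dots> < ennreal \<epsilon>"
    using assms(15) by (simp add: ennreal_less_iff)
  finally show ?thesis by (intro exI[of _ "Suc n"]) simp
qed

end
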